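(* Assume (LipS), (SmS* ) and (SCS* ). Consider Algorithm 3: given $x^{(0)}$, $0<\delta<1$, $0<\epsilon<1$, $0<\epsilon_0<1$, at each iteration $k$: draw a sample $\mathcal S_0$ of size $\ge16(K^* )^2\ln(2p/\delta)/((\gamma^* )^2\epsilon_0^2)$ and form $H_0(x^{(k)})$ from it; choose a threshold $\lambda^{(k)}$; draw an independent sample $\mathcal S$ of size $\ge16(K^* )^2\ln(2p/\delta)/((\gamma^* )^2\epsilon^2)$ and form $H(x^{(k)})$ from it; set $\hat H(x^{(k)})=\mathcal P(\lambda^{(k)};H(x^{(k)}))$ and let $x^{(k+1)}$ be given by the update with $\mathbf g=\nabla F(x^{(k)})$, $M=\hat H(x^{(k)})$, $\alpha_k=1$. If $\|x^{(0)}-x^*\|<\frac{\gamma^*}{6(\sqrt p+1/2)L}$, $\epsilon\le1/6$, and at every iteration $$\lambda^{(k)}>\Big(\frac{(6\sqrt p+3)(1-\epsilon)}{(6\sqrt p+2)(1-\epsilon_0)}\Big)\lambda_{\min}\big(H_0(x^{(k)})\big),$$ then for $k_0\ge1$, with probability $(1-\delta)^{2k_0}$, $$\|x^{(k)}-x^*\|\le\rho^{(k-1)}\|x^{(k-1)}-x^*\|,\quad k=1,\dots,k_0,\qquad\text{where }\rho^{(k)}=1-\frac{\gamma^*}{2\lambda^{(k)}}.$$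
   Context: $f_1,\dots,f_n$ are twice differentiable real functions with domains $\mathrm{dom}(f_i)\subseteq\mathbb R^p$; $\mathcal D=\bigcap_i\mathrm{dom}(f_i)$ is open and convex, $\mathcal X\subseteq\mathbb R^p$ is convex, $F=\frac1n\sum_{i=1}^n f_i$, and $x^*$ is a local minimum of $F$ over $\mathcal D\cap\mathcal X$. $\|\cdot\|$ is the Euclidean/spectral norm and $\lambda_{\min}$ the usual smallest eigenvalue. (LipS): there is $L>0$ with $\|\nabla^2f_i(x)-\nabla^2f_i(x^* )\|\le L\|x-x^*\|$ for all $x\in\mathcal D\cap\mathcal X$ and all $i$. (SmS* ): $K^*:=\max_i\|\nabla^2 f_i(x^* )\|<\infty$. (SCS* ): $\gamma^*:=\lambda_{\min}(\nabla^2F(x^* ))>0$. Sub-sampled Hessian: for a collection $\mathcal S$ of indices drawn uniformly at random from $\{1,\dots,n\}$, $H(x)=\frac1{|\mathcal S|}\sum_{j\in\mathcal S}\nabla^2f_j(x)$. Spectral regularization: for symmetric $H=\sum_i\lambda_i(H)v_iv_i^T$, $\mathcal P(\lambda;H)=\sum_{i=1}^p\max\{\lambda_i(H),\lambda\}v_iv_i^T$. Update: $x^{(k+1)}=\arg\min_{x\in\mathcal D\cap\mathcal X}\{F(x^{(k)})+(x-x^{(k)})^T\mathbf g+\frac1{2\alpha_k}(x-x^{(k)})^TM(x-x^{(k)})\}$. *)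

theory Defs
  imports "HOL-Analysis.Analysis" "HOL-Probability.Probability"
begin

definition spec_norm :: "real^'p^'p \<Rightarrow> real" where
  "spec_norm A = onorm (\<lambda>v. A *v v)"

definition lambda_min :: "real^'p^'p \<Rightarrow> real" where
  "lambda_min A = Min {l. \<exists>v. v \<noteq> 0 \<and> A *v v = l *\<^sub>R v}"

definition outer :: "real^'p \<Rightarrow> real^'p \<Rightarrow> real^'p^'p" where
  "outer u w = (\<chi> a b. u $ a * w $ b)"

definition spec_reg :: "real \<Rightarrow> real^'p^'p \<Rightarrow> real^'p^'p" where
  "spec_reg l H = (THE M. \<exists>(v :: 'p \<Rightarrow> real^'p) (mu :: 'p \<Rightarrow> real).
      (\<forall>i j. v i \<bullet> v j = (if i = j then 1 else 0)) \<and>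
      (\<forall>i. H *v v i = mu i *\<^sub>R v i) \<and>
      M = (\<Sum>i\<in>UNIV. max (mu i) l *\<^sub>R outer (v i) (v i)))"

definition subsampled_hess ::
  "(nat \<Rightarrow> real^'p \<Rightarrow> real^'p^'p) \<Rightarrow> (nat \<Rightarrow> nat) \<Rightarrow> nat \<Rightarrow> real^'p \<Rightarrow> real^'p^'p" where
  "subsampled_hess hess S m x = (1 / real m) *\<^sub>R (\<Sum>j<m. hess (S j) x)"

definition sample_pmf :: "nat \<Rightarrow> nat \<Rightarrow> (nat \<Rightarrow> nat) pmf" where
  "sample_pmf n m = Pi_pmf {..<m} 0 (\<lambda>_. pmf_of_set {..<n})"

text \<open>All random draws of k0 iterations of Algorithm 3: at iteration k an
  independent pair (S_0, S) of samples of sizes m0 k and m k.\<close>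
definition alg3_samples_pmf ::
  "nat \<Rightarrow> nat \<Rightarrow> (nat \<Rightarrow> nat) \<Rightarrow> (nat \<Rightarrow> nat) \<Rightarrow> (nat \<Rightarrow> (nat \<Rightarrow> nat) \<times> (nat \<Rightarrow> nat)) pmf" where
  "alg3_samples_pmf n k0 m0 m =
     Pi_pmf {..<k0} (\<lambda>_. 0, \<lambda>_. 0) (\<lambda>k. pair_pmf (sample_pmf n (m0 k)) (sample_pmf n (m k)))"

text \<open>Quadratic model minimised by the update (alpha_k = 1).\<close>
definition quad_model ::
  "real \<Rightarrow> real^'p \<Rightarrow> real^'p \<Rightarrow> real^'p^'p \<Rightarrow> real^'p \<Rightarrow> real" where
  "quad_model Fx xk g M x = Fx + (x - xk) \<bullet> g + (1/2) * ((x - xk) \<bullet> (M *v (x - xk)))"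

end

theory Submission
  imports Defs
begin

text \<open>
  Comparing the optimality conditions of the quadratic model and of the local minimum bounds
  \<open>lam * norm (x k+1 - x*)\<close> by the distance of the regularized sub-sampled Hessian from the mean
  Hessian along the segment, times \<open>norm (x k - x*)\<close>. That distance splits into a Lipschitz term
  amplified by \<open>sqrt p\<close>, the shift \<open>max 0 (lam - lambda_min)\<close> caused by the regularization, and the
  sampling error at \<open>x*\<close>. Randomness enters through the Hessians at the fixed point \<open>x*\<close> alone, so one
  event serves all trajectories.

  The sampling error is controlled by a matrix Hoeffding inequality. Its proof avoids the
  Golden-Thompson inequality: the trace moment generating function is differentiated and one sample is
  exchanged for an independent copy, after which a mean value inequality for traces gives a
  differential inequality.
\<close>

subsection \<open>Spectral theory of real symmetric matrices\<close>

text \<open>Let d be the current distance to the minimizer, gamma the smallest eigenvalue of the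
  mean Hessian there and tau the sampling error. A step may spend at most lam - gamma / 2. The
  sample size is the one at which Hoeffding's bound gives tau = eps * gamma / 2, hence at most gamma
  / 12; the starting radius is the one at which the terms in L * d cost at most gamma / 6. The
  sampling error is paid twice: directly, and through the smallest eigenvalue that determines the
  shift. The constants of the threshold rule cancel the possible loss in \<open>lambda_min\<close>
  of the auxiliary sample and leave lam > (1 - eps) * gamma.

  The constraint set rules out a closed form for the step, so the argument runs through variational
  inequalities. Symmetry of the Hessians, on which all spectral arguments rest, has to be derived
  from twofold differentiability, without continuity of the second derivative.\<close>

lemma nonneg_if_quadratic_nonneg_near_zero:
  fixes a b :: real
  assumes "\<And>t. 0 < t \<Longrightarrow> t \<le> 1 \<Longrightarrow> 0 \<le> a * t + b * t\<^sup>2"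
  shows "0 \<le> a"
proof (rule ccontr)
  assume "\<not> 0 \<le> a"
  then have a: "a < 0" by simp
  \<comment> \<open>At this \<open>t\<close> the quadratic term is at most half the linear one, so
    the sum keeps the sign of \<open>a\<close>.\<close>
  define t where "t = min 1 (- a / (2 * (\<bar>b\<bar> + 1)))"
  have t: "0 < t" "t \<le> 1" using a by (auto simp: t_def intro!: divide_neg_pos)
  have "\<bar>b\<bar> * t \<le> (\<bar>b\<bar> + 1) * (- a / (2 * (\<bar>b\<bar> + 1)))"
    using t by (intro mult_mono) (auto simp: t_def)
  also have "\<dots> = - a / 2" by (simp add: field_simps)
  finally have "b * t \<le> - a / 2" using t mult_right_mono[OF abs_ge_self, of t b] by linarith
  then have "(a + b * t) * t < 0" using a t by (intro mult_neg_pos) auto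
  then show False using assms[OF t] by (simp add: algebra_simps power2_eq_square)
qed

lemma symmetric_matrix_inner:
  fixes A :: "real^'p^'p"
  assumes "transpose A = A"
  shows "(A *v x) \<bullet> y = x \<bullet> (A *v y)"
  using dot_lmul_matrix[of x A y] vector_transpose_matrix[of x A] assms by simp

lemma symmetric_matrix_diff:
  fixes A B :: "real^'p^'p"
  assumes "transpose A = A" "transpose B = B"
  shows "transpose (A - B) = A - B"
  using assms by (simp add: transpose_def vec_eq_iff)

lemma matrix_vector_mult_sum_right:
  fixes A :: "real^'n^'m"
  shows "A *v sum f I = (\<Sum>i\<in>I. A *v f i)"
  by (rule linear_sum) (rule matrix_vector_mul_linear)

lemma matrix_vector_mult_sum_left:
  fixes A :: "'i \<Rightarrow> real^'n^'m"
  shows "sum A I *v x = (\<Sum>i\<in>I. A i *v x)"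
  by (induction I rule: infinite_finite_induct) (simp_all add: matrix_vector_mult_add_rdistrib)

text \<open>The index type is that of the coordinates, so orthonormality alone makes
  \<open>v\<close> a basis. Eigenvalues are repeated by multiplicity and carry no order. The
  condition is the one under the quantifier in \<open>spec_reg\<close>.\<close>

definition eigensystem :: "real^'p^'p \<Rightarrow> ('p \<Rightarrow> real^'p) \<Rightarrow> ('p \<Rightarrow> real) \<Rightarrow> bool" where
  "eigensystem A v mu \<longleftrightarrow>
     (\<forall>i j. v i \<bullet> v j = (if i = j then 1 else 0)) \<and> (\<forall>i. A *v v i = mu i *\<^sub>R v i)"

text \<open>The orthogonal complement \<open>W\<close> of known eigenvectors is invariant under a
  symmetric matrix, and a maximizer of the quadratic form on the unit sphere of \<open>W\<close> is
  an eigenvector. Working inside the full space spares an induction over matrices of smaller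
  size.\<close>

lemma eigenvector_extension:
  fixes A :: "real^'p^'p"
  assumes A: "transpose A = A" and S: "finite S" "card S < CARD('p)"
    and ev: "\<And>s. s \<in> S \<Longrightarrow> \<exists>l. A *v s = l *\<^sub>R s"
  shows "\<exists>v l. norm v = 1 \<and> (\<forall>s\<in>S. s \<bullet> v = 0) \<and> A *v v = l *\<^sub>R v"
proof -
  note sym = symmetric_matrix_inner[OF A]
  define W where "W = {x. \<forall>s\<in>S. s \<bullet> x = 0}"
  have AW: "A *v x \<in> W" if "x \<in> W" for x
  proof -
    have "s \<bullet> (A *v x) = 0" if s: "s \<in> S" for s
    proof -
      obtain l where "A *v s = l *\<^sub>R s" using ev[OF s] by blast
      then have "s \<bullet> (A *v x) = l * (s \<bullet> x)" by (simp add: sym[symmetric])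
      then show ?thesis using \<open>x \<in> W\<close> s by (simp add: W_def)
    qed
    then show ?thesis by (simp add: W_def)
  qed
  have "dim S < DIM(real^'p)" using S dim_le_card'[of S] by simp
  then obtain x where x: "x \<noteq> 0" "\<And>y. y \<in> span S \<Longrightarrow> orthogonal x y"
    using orthogonal_to_subspace_exists by blast
  have xW: "x \<in> W" using x(2)
    by (auto simp: W_def orthogonal_def inner_commute span_base)
  have scW: "c *\<^sub>R y \<in> W" if "y \<in> W" for c y using that by (simp add: W_def)
  define K where "K = W \<inter> sphere 0 1"
  define q where "q x = x \<bullet> (A *v x)" for x
  have "W = (\<Inter>s\<in>S. {x. s \<bullet> x = 0})" by (auto simp: W_def)
  then have "closed W" by (simp add: closed_hyperplane closed_INT)
  then have "compact K" unfolding K_def by (simp add: closed_Int_compact)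
  moreover have "(1 / norm x) *\<^sub>R x \<in> K" using x xW scW by (simp add: K_def)
  moreover have "continuous_on K q" unfolding q_def
    by (intro continuous_intros linear_continuous_on matrix_vector_mul_bounded_linear)
  ultimately obtain v where v: "v \<in> K" "\<And>y. y \<in> K \<Longrightarrow> q y \<le> q v"
    using continuous_attains_sup[of K q] by blast
  have vW: "v \<in> W" and nv: "norm v = 1" using v by (auto simp: K_def)
  have vv: "v \<bullet> v = 1" using nv by (simp add: dot_square_norm)
  \<comment> \<open>The homogeneous form of maximality spares normalizing the perturbed vector
    below.\<close>
  have qle: "q y \<le> q v * (norm y)\<^sup>2" if y: "y \<in> W" for y
  proof (cases "y = 0")
    case False
    have "(1 / norm y) *\<^sub>R y \<in> K" using False y scW by (simp add: K_def)
    from v(2)[OF this] have "q y / (norm y)\<^sup>2 \<le> q v"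
      by (simp add: q_def matrix_vector_mult_scaleR power2_eq_square)
    then show ?thesis using False by (simp add: field_simps)
  qed (simp add: q_def)
  \<comment> \<open>The residual of the eigenvector equation. Moving from \<open>v\<close> in
    direction \<open>z\<close> raises the form at first order by \<open>2 * (z \<bullet> z)\<close>
    while the norm changes only at second order, so maximality forces \<open>z = 0\<close>.\<close>
  define z where "z = A *v v - q v *\<^sub>R v"
  have zW: "z \<in> W" using vW AW[OF vW] by (simp add: z_def W_def inner_diff_right)
  have zv: "z \<bullet> v = 0" using vv sym[of v v] by (simp add: z_def inner_diff_left q_def)
  have zA: "z \<bullet> (A *v v) = z \<bullet> z"
    using zv by (simp add: z_def inner_diff_left inner_diff_right vv algebra_simps inner_commute)
  have "0 \<le> - (2 * (z \<bullet> z))"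
  proof (rule nonneg_if_quadratic_nonneg_near_zero)
    fix t :: real
    have "v + t *\<^sub>R z \<in> W" using vW zW by (simp add: W_def inner_add_right)
    moreover have "(norm (v + t *\<^sub>R z))\<^sup>2 = 1 + t\<^sup>2 * (z \<bullet> z)"
      unfolding power2_norm_eq_inner
      using zv vv by (simp add: inner_add_left inner_add_right inner_commute power2_eq_square)
    ultimately have "q (v + t *\<^sub>R z) \<le> q v * (1 + t\<^sup>2 * (z \<bullet> z))"
      using qle by metis
    moreover have "q (v + t *\<^sub>R z) = q v + 2 * t * (z \<bullet> z) + t\<^sup>2 * q z"
      using zA sym[of z v] sym[of v z]
      by (simp add: q_def matrix_vector_right_distrib matrix_vector_mult_scaleR inner_add_left
          inner_add_right power2_eq_square algebra_simps inner_commute)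
    ultimately show "0 \<le> - (2 * (z \<bullet> z)) * t + (q v * (z \<bullet> z) - q z) * t\<^sup>2"
      by (simp add: algebra_simps)
  qed
  then have "z \<bullet> z = 0" by (metis antisym inner_ge_zero neg_0_le_iff_le mult_le_0_iff not_numeral_le_zero)
  then have "A *v v = q v *\<^sub>R v" by (simp add: z_def)
  then show ?thesis using nv vW by (auto simp: W_def)
qed

lemma spectral_theorem_symmetric:
  fixes A :: "real^'p^'p"
  assumes A: "transpose A = A"
  obtains v mu where "eigensystem A v mu"
proof -
  have "\<exists>S. finite S \<and> card S = k \<and> (\<forall>s\<in>S. \<exists>l. A *v s = l *\<^sub>R s) \<and>
      (\<forall>s\<in>S. \<forall>t\<in>S. s \<bullet> t = (if s = t then 1 else 0))" if "k \<le> CARD('p)" for k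
    using that
  proof (induction k)
    case 0
    then show ?case by (intro exI[of _ "{}"]) auto
  next
    case (Suc k)
    then obtain S where S: "finite S" "card S = k" "\<forall>s\<in>S. \<exists>l. A *v s = l *\<^sub>R s"
      "\<forall>s\<in>S. \<forall>t\<in>S. s \<bullet> t = (if s = t then 1 else 0)" by auto
    with Suc.prems obtain v l where v: "norm v = 1" "\<forall>s\<in>S. s \<bullet> v = 0" "A *v v = l *\<^sub>R v"
      using eigenvector_extension[OF A, of S] by auto
    then have "v \<bullet> v = 1" by (simp add: dot_square_norm)
    moreover from this have "v \<notin> S" using v by auto
    ultimately show ?case using S v
      by (intro exI[of _ "insert v S"]) (auto simp: inner_commute)
  qed
  from this[of "CARD('p)"] obtain S where S: "finite S" "card S = CARD('p)"
    "\<forall>s\<in>S. \<exists>l. A *v s = l *\<^sub>R s" "\<forall>s\<in>S. \<forall>t\<in>S. s \<bullet> t = (if s = t then 1 else 0)" by auto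
  obtain v where v: "bij_betw v (UNIV :: 'p set) S"
    using finite_same_card_bij[of "UNIV :: 'p set" S] S by auto
  have vS: "v i \<in> S" for i using v by (auto simp: bij_betw_def)
  have "\<forall>i. \<exists>l. A *v v i = l *\<^sub>R v i" using S(3) vS by blast
  then obtain mu where "\<forall>i. A *v v i = mu i *\<^sub>R v i" using choice by meson
  moreover have "v i \<bullet> v j = (if i = j then 1 else 0)" for i j
    using S(4) vS[of i] vS[of j] bij_betw_imp_inj_on[OF v] by (simp add: inj_eq)
  ultimately show ?thesis by (intro that[of v mu]) (simp add: eigensystem_def)
qed

lemma orthonormal_family_expansion:
  fixes v :: "'p \<Rightarrow> real^'p"
  assumes v: "\<And>i j. v i \<bullet> v j = (if i = j then 1 else 0)"
  shows "x = (\<Sum>i\<in>UNIV. (v i \<bullet> x) *\<^sub>R v i)"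
proof -
  have inj: "inj v" by (metis injI v zero_neq_one)
  have nz: "0 \<notin> range v" by (metis imageE inner_zero_left v zero_neq_one)
  have "pairwise orthogonal (range v)"
    using v by (auto simp: pairwise_def orthogonal_def)
  then have "independent (range v)" using nz by (rule pairwise_orthogonal_independent)
  then have span: "span (range v) = UNIV"
    using card_image[OF inj] by (intro card_ge_dim_independent[THEN subset_antisym[OF subset_UNIV]])
      auto
  define y where "y = x - (\<Sum>i\<in>UNIV. (v i \<bullet> x) *\<^sub>R v i)"
  have "v j \<bullet> y = 0" for j
    by (simp add: y_def inner_diff_right inner_sum_right v if_distrib cong: if_cong)
  then have "orthogonal y z" for z
    using span by (intro orthogonal_to_span[of z "range v"]) (auto simp: orthogonal_def inner_commute)
  then have "y = 0" using orthogonal_self by blast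
  then show ?thesis by (simp add: y_def)
qed

lemma orthonormal_family_inner:
  fixes v :: "'p \<Rightarrow> real^'p"
  assumes v: "\<And>i j. v i \<bullet> v j = (if i = j then 1 else 0)"
  shows "x \<bullet> y = (\<Sum>i\<in>UNIV. (v i \<bullet> x) * (v i \<bullet> y))"
proof -
  have "x \<bullet> y = (\<Sum>i\<in>UNIV. (v i \<bullet> x) *\<^sub>R v i) \<bullet> y"
    using orthonormal_family_expansion[of v x] v by simp
  then show ?thesis by (simp add: inner_sum_left)
qed

lemma orthonormal_family_norm:
  fixes v :: "'p \<Rightarrow> real^'p"
  assumes v: "\<And>i j. v i \<bullet> v j = (if i = j then 1 else 0)"
  shows "(norm x)\<^sup>2 = (\<Sum>i\<in>UNIV. (v i \<bullet> x)\<^sup>2)"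
  using orthonormal_family_inner[OF v, of x x] unfolding power2_norm_eq_inner
  by (simp add: power2_eq_square)

context
  fixes A :: "real^'p^'p" and v mu
  assumes es: "eigensystem A v mu"
begin

lemma eigensystem_orthonormal: "v i \<bullet> v j = (if i = j then 1 else 0)"
  using es by (simp add: eigensystem_def)

lemma eigensystem_eigenvector: "A *v v i = mu i *\<^sub>R v i"
  using es by (simp add: eigensystem_def)

lemma eigensystem_norm: "norm (v i) = 1"
  by (simp add: norm_eq_sqrt_inner eigensystem_orthonormal)

lemma eigensystem_apply: "A *v x = (\<Sum>i\<in>UNIV. (mu i * (v i \<bullet> x)) *\<^sub>R v i)"
proof -
  have "A *v x = A *v (\<Sum>i\<in>UNIV. (v i \<bullet> x) *\<^sub>R v i)"
    using orthonormal_family_expansion[of v x] eigensystem_orthonormal by simp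
  then show ?thesis
    by (simp add: matrix_vector_mult_sum_right matrix_vector_mult_scaleR eigensystem_eigenvector
        mult.commute)
qed

lemma eigensystem_coordinate: "v i \<bullet> (A *v x) = mu i * (v i \<bullet> x)"
  by (simp add: eigensystem_apply inner_sum_right eigensystem_orthonormal if_distrib cong: if_cong)

lemma eigensystem_inner: "x \<bullet> (A *v y) = (\<Sum>i\<in>UNIV. mu i * ((v i \<bullet> x) * (v i \<bullet> y)))"
  by (subst orthonormal_family_inner[of v, OF eigensystem_orthonormal])
    (simp add: eigensystem_coordinate algebra_simps)

lemma eigensystem_selfadjoint: "(A *v x) \<bullet> y = x \<bullet> (A *v y)"
  by (simp add: eigensystem_inner inner_commute[of "A *v x"] mult.commute mult.left_commute)

lemma eigensystem_quadratic_form: "x \<bullet> (A *v x) = (\<Sum>i\<in>UNIV. mu i * (v i \<bullet> x)\<^sup>2)"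
  by (simp add: eigensystem_inner power2_eq_square)

lemma eigensystem_quadratic_form_ge:
  assumes "\<And>i. c \<le> mu i"
  shows "c * (norm x)\<^sup>2 \<le> x \<bullet> (A *v x)"
  unfolding eigensystem_quadratic_form
    orthonormal_family_norm[of v, OF eigensystem_orthonormal] sum_distrib_left
  by (intro sum_mono mult_right_mono assms) auto

lemma eigensystem_norm_le:
  assumes "\<And>i. \<bar>mu i\<bar> \<le> c"
  shows "norm (A *v x) \<le> c * norm x"
proof (rule power2_le_imp_le)
  have c: "0 \<le> c" using assms[of undefined] by linarith
  have "(norm (A *v x))\<^sup>2 = (\<Sum>i\<in>UNIV. (mu i)\<^sup>2 * (v i \<bullet> x)\<^sup>2)"
    by (simp add: orthonormal_family_norm[of v, OF eigensystem_orthonormal]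
        eigensystem_coordinate power_mult_distrib)
  also have "\<dots> \<le> (\<Sum>i\<in>UNIV. c\<^sup>2 * (v i \<bullet> x)\<^sup>2)"
    using assms c by (intro sum_mono mult_right_mono) (auto simp: abs_le_square_iff[symmetric])
  also have "\<dots> = (c * norm x)\<^sup>2"
    by (simp add: power_mult_distrib sum_distrib_left
        orthonormal_family_norm[of v, OF eigensystem_orthonormal])
  finally show "(norm (A *v x))\<^sup>2 \<le> (c * norm x)\<^sup>2" .
  show "0 \<le> c * norm x" using c by simp
qed

text \<open>Gives meaning to the \<open>Min\<close> in \<open>lambda_min\<close>: the set is finite
  and nonempty. An eigenvector has a nonzero coordinate along some \<open>v i\<close>, and that
  coordinate identifies its eigenvalue.\<close>

lemma eigenvalue_set: "{l. \<exists>x. x \<noteq> 0 \<and> A *v x = l *\<^sub>R x} = range mu"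
proof (intro equalityI subsetI)
  fix l assume "l \<in> {l. \<exists>x. x \<noteq> 0 \<and> A *v x = l *\<^sub>R x}"
  then obtain x where x: "x \<noteq> 0" "A *v x = l *\<^sub>R x" by auto
  have "\<exists>i. v i \<bullet> x \<noteq> 0"
  proof (rule ccontr)
    assume "\<not> (\<exists>i. v i \<bullet> x \<noteq> 0)"
    then have "(norm x)\<^sup>2 = 0" by (simp add: orthonormal_family_norm[OF eigensystem_orthonormal])
    then show False using x(1) by simp
  qed
  then obtain i where "v i \<bullet> x \<noteq> 0" by blast
  moreover have "mu i * (v i \<bullet> x) = l * (v i \<bullet> x)"
    using eigensystem_coordinate[of i x] unfolding x(2) by auto
  ultimately show "l \<in> range mu" by auto
next
  fix l assume "l \<in> range mu"
  then obtain i where "l = mu i" by auto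
  moreover have "v i \<noteq> 0" using eigensystem_norm[of i] by auto
  ultimately show "l \<in> {l. \<exists>x. x \<noteq> 0 \<and> A *v x = l *\<^sub>R x}"
    using eigensystem_eigenvector by auto
qed

lemma lambda_min_eigensystem: "lambda_min A = Min (range mu)"
  by (simp add: lambda_min_def eigenvalue_set)

end

lemma lambda_min_le_quadratic_form:
  fixes A :: "real^'p^'p"
  assumes "transpose A = A"
  shows "lambda_min A * (norm x)\<^sup>2 \<le> x \<bullet> (A *v x)"
proof -
  obtain v mu where es: "eigensystem A v mu" using spectral_theorem_symmetric[OF assms] .
  show ?thesis
    using eigensystem_quadratic_form_ge[OF es] by (simp add: lambda_min_eigensystem[OF es])
qed

lemma lambda_min_ge:
  fixes A :: "real^'p^'p"
  assumes "transpose A = A" and le: "\<And>x. norm x = 1 \<Longrightarrow> c \<le> x \<bullet> (A *v x)"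
  shows "c \<le> lambda_min A"
proof -
  obtain v mu where es: "eigensystem A v mu" using spectral_theorem_symmetric[OF assms(1)] .
  have "c \<le> mu i" for i
    using le[OF eigensystem_norm[OF es], of i]
    by (simp add: eigensystem_eigenvector[OF es] eigensystem_orthonormal[OF es])
  then show ?thesis by (simp add: lambda_min_eigensystem[OF es])
qed

text \<open>One half of Weyl's inequality. It controls both the threshold, through the auxiliary
  sample, and the shift caused by regularization.\<close>

lemma lambda_min_perturbation:
  fixes A B :: "real^'p^'p"
  assumes "transpose A = A" "transpose B = B" and le: "\<And>v. norm ((A - B) *v v) \<le> c * norm v"
  shows "lambda_min B - c \<le> lambda_min A"
proof (rule lambda_min_ge[OF assms(1)])
  fix v :: "real^'p" assume v: "norm v = 1"
  have "- (norm v * norm ((A - B) *v v)) \<le> v \<bullet> ((A - B) *v v)"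
    using Cauchy_Schwarz_ineq2[of v "(A - B) *v v"] by linarith
  moreover have "norm ((A - B) *v v) \<le> c" using le[of v] v by simp
  moreover have "lambda_min B \<le> v \<bullet> (B *v v)"
    using lambda_min_le_quadratic_form[OF assms(2), of v] v by simp
  ultimately show "lambda_min B - c \<le> v \<bullet> (A *v v)"
    using v by (simp add: matrix_vector_mult_diff_rdistrib inner_diff_right)
qed

text \<open>For a symmetric matrix the numerical radius is the operator norm; two one-sided tail
  bounds on the quadratic form thus become a norm bound.\<close>

lemma symmetric_norm_le:
  fixes A :: "real^'p^'p"
  assumes "transpose A = A" and le: "\<And>x. norm x = 1 \<Longrightarrow> \<bar>x \<bullet> (A *v x)\<bar> \<le> c"
  shows "norm (A *v x) \<le> c * norm x"
proof -
  obtain v mu where es: "eigensystem A v mu" using spectral_theorem_symmetric[OF assms(1)] .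
  have "\<bar>mu i\<bar> \<le> c" for i
    using le[OF eigensystem_norm[OF es], of i]
    by (simp add: eigensystem_eigenvector[OF es] eigensystem_orthonormal[OF es])
  then show ?thesis using eigensystem_norm_le[OF es] by blast
qed

subsection \<open>Spectral regularization\<close>

lemma eigensystem_reg_sum:
  fixes A :: "real^'p^'p"
  assumes es: "eigensystem A v mu"
  shows "eigensystem (\<Sum>i\<in>UNIV. g (mu i) *\<^sub>R outer (v i) (v i)) v (\<lambda>i. g (mu i))"
proof -
  have outer: "outer u w *v x = (w \<bullet> x) *\<^sub>R u" for u w x :: "real^'p"
    by (simp add: outer_def vec_eq_iff matrix_vector_mult_def inner_vec_def sum_distrib_left
        algebra_simps)
  have "(\<Sum>i\<in>UNIV. g (mu i) *\<^sub>R outer (v i) (v i)) *v v j = g (mu j) *\<^sub>R v j" for j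
  proof -
    have "(\<Sum>i\<in>UNIV. g (mu i) *\<^sub>R outer (v i) (v i)) *v v j
        = (\<Sum>i\<in>UNIV. if i = j then g (mu j) *\<^sub>R v j else 0)"
      unfolding matrix_vector_mult_sum_left scaleR_matrix_vector_assoc[symmetric] outer
      by (intro sum.cong) (auto simp: eigensystem_orthonormal[OF es])
    then show ?thesis by simp
  qed
  then show ?thesis using es by (simp add: eigensystem_def)
qed

text \<open>The device for comparing functions of two matrices that do not commute: in mixed
  coordinates, one eigenbasis on each side, applying a scalar function to both matrices only
  replaces \<open>a i - b j\<close> by the difference of the function values.\<close>

lemma double_eigensystem_coordinate:
  fixes A B :: "real^'p^'p"
  assumes A: "eigensystem A u a" and B: "eigensystem B w b"
  shows "u i \<bullet> ((A - B) *v w j) = (a i - b j) * (u i \<bullet> w j)"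
  by (simp add: matrix_vector_mult_diff_rdistrib inner_diff_right eigensystem_coordinate[OF A]
      eigensystem_eigenvector[OF B] algebra_simps)

text \<open>A scalar Lipschitz function acts as a Lipschitz map on symmetric matrices only in the
  Frobenius norm; this is the origin of the factor \<open>sqrt p\<close>.\<close>

lemma regularization_lipschitz:
  fixes A B A' B' :: "real^'p^'p"
  assumes A: "eigensystem A u a" and B: "eigensystem B w b"
    and A': "eigensystem A' u (\<lambda>i. max (a i) l)" and B': "eigensystem B' w (\<lambda>i. max (b i) l)"
    and le: "\<And>x. norm ((A - B) *v x) \<le> c * norm x"
  shows "norm ((A' - B') *v x) \<le> sqrt (real CARD('p)) * c * norm x"
proof -
  note ou = eigensystem_orthonormal[OF A] and ow = eigensystem_orthonormal[OF B]
  have c: "0 \<le> c" using le[of "w undefined"] eigensystem_norm[OF B] norm_ge_zero order_trans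
    by (metis mult.right_neutral)
  \<comment> \<open>The squared Frobenius norm of \<open>A' - B'\<close>, computed in the basis
    \<open>w\<close>.\<close>
  define T where "T = (\<Sum>j\<in>UNIV. (norm ((A' - B') *v w j))\<^sup>2)"
  have "T = (\<Sum>j\<in>UNIV. \<Sum>i\<in>UNIV. (max (a i) l - max (b j) l)\<^sup>2 * (u i \<bullet> w j)\<^sup>2)"
    by (simp add: T_def orthonormal_family_norm[of u, OF ou] double_eigensystem_coordinate[OF A' B']
        power_mult_distrib)
  also have "\<dots> \<le> (\<Sum>j\<in>UNIV. \<Sum>i\<in>UNIV. (a i - b j)\<^sup>2 * (u i \<bullet> w j)\<^sup>2)"
    by (intro sum_mono mult_right_mono) (auto simp: abs_le_square_iff[symmetric])
  also have "\<dots> = (\<Sum>j\<in>UNIV. (norm ((A - B) *v w j))\<^sup>2)"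
    by (simp add: orthonormal_family_norm[of u, OF ou] double_eigensystem_coordinate[OF A B]
        power_mult_distrib)
  \<comment> \<open>Each of the \<open>CARD('p)\<close> unit vectors \<open>w j\<close> contributes
    at most \<open>c\<^sup>2\<close>; this is where the dimension enters.\<close>
  also have "\<dots> \<le> (\<Sum>j\<in>(UNIV :: 'p set). c\<^sup>2)"
    using le eigensystem_norm[OF B] by (intro sum_mono power_mono) (metis mult.right_neutral, simp)
  finally have T: "T \<le> real CARD('p) * c\<^sup>2" by simp
  have "norm ((A' - B') *v x) = norm (\<Sum>j\<in>UNIV. (w j \<bullet> x) *\<^sub>R ((A' - B') *v w j))"
    by (subst orthonormal_family_expansion[of w x, OF ow])
      (simp add: matrix_vector_mult_sum_right matrix_vector_mult_scaleR)
  also have "\<dots> \<le> (\<Sum>j\<in>UNIV. \<bar>w j \<bullet> x\<bar> * norm ((A' - B') *v w j))"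
    using norm_sum[of "\<lambda>j. (w j \<bullet> x) *\<^sub>R ((A' - B') *v w j)" UNIV] by simp
  also have "\<dots> \<le> L2_set (\<lambda>j. w j \<bullet> x) UNIV * L2_set (\<lambda>j. norm ((A' - B') *v w j)) UNIV"
    using L2_set_mult_ineq[of "\<lambda>j. w j \<bullet> x" "\<lambda>j. norm ((A' - B') *v w j)" UNIV] by simp
  also have "\<dots> = norm x * sqrt T"
    by (simp add: L2_set_def T_def orthonormal_family_norm[of w, OF ow, symmetric])
  also have "\<dots> \<le> norm x * sqrt (real CARD('p) * c\<^sup>2)"
    using T by (intro mult_left_mono) auto
  finally show ?thesis using c by (simp add: real_sqrt_mult mult_ac)
qed

text \<open>\<open>spec_reg\<close> is a definite description, so the regularized sum must not
  depend on the eigenbasis chosen. This is the Lipschitz bound with constant 0, applied to two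
  eigensystems of the same matrix.\<close>

lemma spec_reg_eigensystem:
  fixes H :: "real^'p^'p"
  assumes es: "eigensystem H v mu"
  shows "eigensystem (spec_reg l H) v (\<lambda>i. max (mu i) l)"
proof -
  let ?R = "\<lambda>(v :: 'p \<Rightarrow> real^'p) mu. (\<Sum>i\<in>UNIV. max (mu i) l *\<^sub>R outer (v i) (v i))"
  have R: "eigensystem (?R w b) w (\<lambda>i. max (b i) l)" if "eigensystem H w b" for w b
    using eigensystem_reg_sum[OF that, of "\<lambda>t. max t l"] .
  have eq: "?R w b = ?R v mu" if w: "eigensystem H w b" for w b
  proof -
    have "norm ((?R w b - ?R v mu) *v x) \<le> sqrt (real CARD('p)) * 0 * norm x" for x
      by (rule regularization_lipschitz[OF w es R[OF w] R[OF es]]) simp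
    then have "?R w b *v x = ?R v mu *v x" for x by (simp add: matrix_vector_mult_diff_rdistrib)
    then show ?thesis using matrix_eq by blast
  qed
  have "spec_reg l H = ?R v mu"
    unfolding spec_reg_def
  proof (rule the_equality)
    show "\<exists>w b. (\<forall>i j. w i \<bullet> w j = (if i = j then 1 else 0)) \<and> (\<forall>i. H *v w i = b i *\<^sub>R w i) \<and>
        ?R v mu = ?R w b"
      using es unfolding eigensystem_def by blast
  next
    fix M assume "\<exists>w b. (\<forall>i j. w i \<bullet> w j = (if i = j then 1 else 0)) \<and>
        (\<forall>i. H *v w i = b i *\<^sub>R w i) \<and> M = ?R w b"
    then obtain w b where "eigensystem H w b" "M = ?R w b" unfolding eigensystem_def by blast
    then show "M = ?R v mu" using eq by simp
  qed
  then show ?thesis using R[OF es] by simp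
qed

lemma spec_reg_lipschitz:
  fixes A B :: "real^'p^'p"
  assumes "transpose A = A" "transpose B = B" "\<And>x. norm ((A - B) *v x) \<le> c * norm x"
  shows "norm ((spec_reg l A - spec_reg l B) *v x) \<le> sqrt (real CARD('p)) * c * norm x"
proof -
  obtain u a where A: "eigensystem A u a" using spectral_theorem_symmetric[OF assms(1)] .
  obtain w b where B: "eigensystem B w b" using spectral_theorem_symmetric[OF assms(2)] .
  show ?thesis
    using regularization_lipschitz[OF A B spec_reg_eigensystem[OF A] spec_reg_eigensystem[OF B]
        assms(3)] .
qed

lemma spec_reg_selfadjoint:
  fixes H :: "real^'p^'p"
  assumes "transpose H = H"
  shows "(spec_reg l H *v x) \<bullet> y = x \<bullet> (spec_reg l H *v y)"
  by (metis assms eigensystem_selfadjoint spec_reg_eigensystem spectral_theorem_symmetric)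

lemma spec_reg_quadratic_form_ge:
  fixes H :: "real^'p^'p"
  assumes "transpose H = H"
  shows "l * (norm x)\<^sup>2 \<le> x \<bullet> (spec_reg l H *v x)"
proof -
  obtain v mu where es: "eigensystem H v mu" using spectral_theorem_symmetric[OF assms] .
  show ?thesis by (rule eigensystem_quadratic_form_ge[OF spec_reg_eigensystem[OF es]]) simp
qed

text \<open>Both matrices share an eigenbasis, so no dimension factor appears, and the lowest
  eigenvalue is raised most.\<close>

lemma spec_reg_perturbation:
  fixes H :: "real^'p^'p"
  assumes "transpose H = H"
  shows "norm ((spec_reg l H - H) *v x) \<le> max 0 (l - lambda_min H) * norm x"
proof -
  obtain v mu where es: "eigensystem H v mu" using spectral_theorem_symmetric[OF assms] .
  have "eigensystem (spec_reg l H - H) v (\<lambda>i. max (mu i) l - mu i)"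
    using spec_reg_eigensystem[OF es, of l] es
    by (simp add: eigensystem_def matrix_vector_mult_diff_rdistrib scaleR_diff_left)
  moreover have "\<bar>max (mu i) l - mu i\<bar> \<le> max 0 (l - lambda_min H)" for i
  proof -
    have "lambda_min H \<le> mu i" by (simp add: lambda_min_eigensystem[OF es])
    then show ?thesis by auto
  qed
  ultimately show ?thesis by (rule eigensystem_norm_le)
qed

lemma symmetric_matrix_sum:
  fixes A :: "'i \<Rightarrow> real^'p^'p"
  assumes "\<And>i. i \<in> I \<Longrightarrow> transpose (A i) = A i"
  shows "transpose (sum A I) = sum A I"
proof -
  have "A i $ b $ a = A i $ a $ b" if "i \<in> I" for i a b
    using assms[OF that] by (simp add: transpose_def vec_eq_iff)
  then show ?thesis by (simp add: transpose_def vec_eq_iff)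
qed

lemma symmetric_matrix_scaleR:
  fixes A :: "real^'p^'p"
  assumes "transpose A = A"
  shows "transpose (c *\<^sub>R A) = c *\<^sub>R A"
  using assms by (simp add: transpose_def vec_eq_iff)

subsection \<open>Matrix Hoeffding inequality\<close>

text \<open>Equivalent to \<open>tanh (d / 2) \<le> d / 2\<close>: the logarithmic mean of 1 and
  \<open>exp d\<close> is at most their arithmetic mean.\<close>

lemma exp_diff_le_mean:
  fixes d :: real
  assumes "0 \<le> d"
  shows "exp d - 1 \<le> d / 2 * (exp d + 1)"
proof -
  define g where "g d = d / 2 * (exp d + 1) - exp d + 1" for d :: real
  have "g 0 \<le> g d"
  proof (rule DERIV_nonneg_imp_nondecreasing[OF assms], intro exI conjI)
    fix x :: real
    show "(g has_real_derivative (1 - exp x + x * exp x) / 2) (at x)"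
      unfolding g_def by (auto intro!: derivative_eq_intros simp: field_simps)
    have "1 - x \<le> exp (- x)" using exp_ge_add_one_self[of "- x"] by simp
    then have "exp x * (1 - x) \<le> exp x * exp (- x)" by (intro mult_left_mono) auto
    then show "0 \<le> (1 - exp x + x * exp x) / 2"
      by (simp add: exp_add[symmetric] algebra_simps)
  qed
  then show ?thesis by (simp add: g_def)
qed

text \<open>By symmetry \<open>y \<le> x\<close>; factoring out \<open>exp (t * y)\<close> leaves
  the previous bound at \<open>d = t * (x - y)\<close>. The factor 1/2 determines the 4 in the
  Hoeffding exponent.\<close>

lemma exp_monotone_mean_bound:
  fixes x y t :: real
  assumes "0 \<le> t"
  shows "(x - y) * (exp (t * x) - exp (t * y)) \<le> t / 2 * (x - y)\<^sup>2 * (exp (t * x) + exp (t * y))"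
proof -
  have main: "(x - y) * (exp (t * x) - exp (t * y))
      \<le> t / 2 * (x - y)\<^sup>2 * (exp (t * x) + exp (t * y))" if "y \<le> x" for x y
  proof -
    have "exp (t * (x - y)) - 1 \<le> t * (x - y) / 2 * (exp (t * (x - y)) + 1)"
      using exp_diff_le_mean assms that by simp
    then have "(x - y) * exp (t * y) * (exp (t * (x - y)) - 1)
        \<le> (x - y) * exp (t * y) * (t * (x - y) / 2 * (exp (t * (x - y)) + 1))"
      using that by (intro mult_left_mono) auto
    moreover have "exp (t * x) = exp (t * y) * exp (t * (x - y))"
      by (simp add: exp_add[symmetric] algebra_simps)
    ultimately show ?thesis by (simp add: algebra_simps power2_eq_square)
  qed
  show ?thesis
  proof (cases "y \<le> x")
    case False
    then show ?thesis using main[of x y] by (simp add: algebra_simps power2_eq_square)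
  qed (rule main)
qed

text \<open>For symmetric \<open>A\<close> this is the trace of \<open>B\<close> times the matrix exponential of \<open>t A\<close>.\<close>

definition trace_exp :: "real \<Rightarrow> real^'p^'p \<Rightarrow> real^'p^'p \<Rightarrow> real" where
  "trace_exp t A B = (let vm = (SOME vm. eigensystem A (fst vm) (snd vm)) in
     \<Sum>i\<in>UNIV. exp (t * snd vm i) * (fst vm i \<bullet> (B *v fst vm i)))"

text \<open>The choice inside \<open>trace_exp\<close> depends on \<open>A\<close> alone, so one
  eigensystem serves every \<open>t\<close> and every \<open>B\<close>. This permits termwise
  differentiation in \<open>t\<close> without comparing eigenbases.\<close>

lemma trace_exp_eigensystem:
  fixes A :: "real^'p^'p"
  assumes "transpose A = A"
  obtains v mu where "eigensystem A v mu"
    "\<And>t B. trace_exp t A B = (\<Sum>i\<in>UNIV. exp (t * mu i) * (v i \<bullet> (B *v v i)))"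
proof -
  define vm where "vm = (SOME vm. eigensystem A (fst vm) (snd vm))"
  obtain v mu where "eigensystem A v mu" using spectral_theorem_symmetric[OF assms] .
  then have "eigensystem A (fst (v, mu)) (snd (v, mu))" by simp
  then have "eigensystem A (fst vm) (snd vm)" unfolding vm_def by (rule someI)
  then show ?thesis by (rule that) (simp add: trace_exp_def vm_def Let_def)
qed

lemma trace_exp_diff: "trace_exp t A (B - C) = trace_exp t A B - trace_exp t A C"
  by (simp add: trace_exp_def Let_def matrix_vector_mult_diff_rdistrib inner_diff_right
      right_diff_distrib sum_subtractf)

lemma trace_exp_scaleR: "trace_exp t A (c *\<^sub>R B) = c * trace_exp t A B"
  by (simp add: trace_exp_def Let_def scaleR_matrix_vector_assoc[symmetric] sum_distrib_left
      mult.left_commute)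

lemma trace_exp_sum: "trace_exp t A (sum B I) = (\<Sum>i\<in>I. trace_exp t A (B i))"
  unfolding trace_exp_def Let_def matrix_vector_mult_sum_left inner_sum_right sum_distrib_left
  by (rule sum.swap)

lemma trace_exp_has_derivative:
  fixes A :: "real^'p^'p"
  assumes "transpose A = A"
  shows "((\<lambda>t. trace_exp t A (mat 1)) has_real_derivative trace_exp t A A) (at t)"
proof -
  obtain v mu where es: "eigensystem A v mu"
    and tr: "\<And>t B. trace_exp t A B = (\<Sum>i\<in>UNIV. exp (t * mu i) * (v i \<bullet> (B *v v i)))"
    using trace_exp_eigensystem[OF assms] by metis
  note ev = eigensystem_eigenvector[OF es] eigensystem_orthonormal[OF es]
  show ?thesis unfolding tr
    by (auto simp: ev intro!: derivative_eq_intros sum.cong)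
qed

lemma trace_exp_zero:
  fixes A :: "real^'p^'p"
  assumes "transpose A = A"
  shows "trace_exp 0 A (mat 1) = real CARD('p)"
proof -
  obtain v mu where es: "eigensystem A v mu"
    and tr: "\<And>t B. trace_exp t A B = (\<Sum>i\<in>UNIV. exp (t * mu i) * (v i \<bullet> (B *v v i)))"
    using trace_exp_eigensystem[OF assms] by metis
  show ?thesis by (simp add: tr eigensystem_orthonormal[OF es])
qed

text \<open>The largest eigenvalue dominates the quadratic form on unit vectors, and a sum of
  positive exponentials dominates each of its terms. In the Chernoff argument this makes every bad
  sample contribute a large trace.\<close>

lemma trace_exp_ge:
  fixes A :: "real^'p^'p"
  assumes "transpose A = A" "0 \<le> t" "norm x = 1" "s \<le> x \<bullet> (A *v x)"
  shows "exp (t * s) \<le> trace_exp t A (mat 1)"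
proof -
  obtain v mu where es: "eigensystem A v mu"
    and tr: "\<And>t B. trace_exp t A B = (\<Sum>i\<in>UNIV. exp (t * mu i) * (v i \<bullet> (B *v v i)))"
    using trace_exp_eigensystem[OF assms(1)] by metis
  have "\<exists>i. s \<le> mu i"
  proof (rule ccontr)
    assume "\<not> (\<exists>i. s \<le> mu i)"
    then have less: "mu i < s" for i by (simp add: not_le)
    have "x \<bullet> (A *v x) = (\<Sum>i\<in>UNIV. mu i * (v i \<bullet> x)\<^sup>2)"
      by (rule eigensystem_quadratic_form[OF es])
    also have "\<dots> \<le> (\<Sum>i\<in>(UNIV :: 'p set). Max (range mu) * (v i \<bullet> x)\<^sup>2)"
      by (intro sum_mono mult_right_mono) auto
    also have "\<dots> = Max (range mu)"
      using orthonormal_family_norm[of v x, OF eigensystem_orthonormal[OF es]] assms(3)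
      by (simp add: sum_distrib_left[symmetric])
    also have "\<dots> < s" using less by simp
    finally show False using assms(4) by simp
  qed
  then obtain i where "s \<le> mu i" by blast
  then have "exp (t * s) \<le> exp (t * mu i)" using assms(2) by (simp add: mult_left_mono)
  also have "\<dots> \<le> (\<Sum>i\<in>UNIV. exp (t * mu i))" by (rule member_le_sum) auto
  finally show ?thesis by (simp add: tr eigensystem_orthonormal[OF es])
qed

text \<open>Expanding both traces in the two eigenbases reduces the claim to
  a scalar inequality for pairs of eigenvalues, although \<open>A\<close> and \<open>B\<close> need not commute.\<close>

lemma trace_exp_mean_value:
  fixes A B :: "real^'p^'p"
  assumes "transpose A = A" "transpose B = B" "0 \<le> t"
    and le: "\<And>x. norm ((A - B) *v x) \<le> c * norm x"
  shows "trace_exp t A (A - B) - trace_exp t B (A - B)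
    \<le> t / 2 * c\<^sup>2 * (trace_exp t A (mat 1) + trace_exp t B (mat 1))"
proof -
  obtain u a where A: "eigensystem A u a"
    and trA: "\<And>t B. trace_exp t A B = (\<Sum>i\<in>UNIV. exp (t * a i) * (u i \<bullet> (B *v u i)))"
    using trace_exp_eigensystem[OF assms(1)] by metis
  obtain w b where B: "eigensystem B w b"
    and trB: "\<And>t C. trace_exp t B C = (\<Sum>i\<in>UNIV. exp (t * b i) * (w i \<bullet> (C *v w i)))"
    using trace_exp_eigensystem[OF assms(2)] by metis
  note ou = eigensystem_orthonormal[OF A] and ow = eigensystem_orthonormal[OF B]
  \<comment> \<open>Nonnegative weights coupling the two spectra. Weighted sums of
    \<open>a i - b j\<close> over one index are quadratic forms of \<open>A - B\<close>; weighted
    sums of squares are squared norms of its images of basis vectors.\<close>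
  define C where "C i j = (u i \<bullet> w j)\<^sup>2" for i j
  have uw: "u i \<bullet> ((A - B) *v w j) = (a i - b j) * (u i \<bullet> w j)" for i j
    by (rule double_eigensystem_coordinate[OF A B])
  have wu: "w j \<bullet> ((A - B) *v u i) = (a i - b j) * (u i \<bullet> w j)" for i j
    using double_eigensystem_coordinate[OF B A, of j i]
    by (simp add: matrix_vector_mult_diff_rdistrib inner_diff_right inner_commute algebra_simps)
  have qu: "u i \<bullet> ((A - B) *v u i) = (\<Sum>j\<in>UNIV. (a i - b j) * C i j)" for i
    by (subst orthonormal_family_inner[of w, OF ow])
      (simp add: wu C_def power2_eq_square inner_commute mult_ac)
  have qw: "w j \<bullet> ((A - B) *v w j) = (\<Sum>i\<in>UNIV. (a i - b j) * C i j)" for j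
    by (subst orthonormal_family_inner[of u, OF ou])
      (simp add: uw C_def power2_eq_square mult_ac)
  have nu: "(\<Sum>j\<in>UNIV. (a i - b j)\<^sup>2 * C i j) \<le> c\<^sup>2" for i
  proof -
    have "(\<Sum>j\<in>UNIV. (a i - b j)\<^sup>2 * C i j) = (norm ((A - B) *v u i))\<^sup>2"
      by (simp add: orthonormal_family_norm[of w, OF ow] wu C_def power_mult_distrib)
    also have "\<dots> \<le> c\<^sup>2"
      using le[of "u i"] eigensystem_norm[OF A] by (intro power_mono) auto
    finally show ?thesis .
  qed
  have nw: "(\<Sum>i\<in>UNIV. (a i - b j)\<^sup>2 * C i j) \<le> c\<^sup>2" for j
  proof -
    have "(\<Sum>i\<in>UNIV. (a i - b j)\<^sup>2 * C i j) = (norm ((A - B) *v w j))\<^sup>2"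
      by (simp add: orthonormal_family_norm[of u, OF ou] uw C_def power_mult_distrib)
    also have "\<dots> \<le> c\<^sup>2"
      using le[of "w j"] eigensystem_norm[OF B] by (intro power_mono) auto
    finally show ?thesis .
  qed
  let ?E = "\<lambda>i. exp (t * a i)" and ?G = "\<lambda>j. exp (t * b j)"
  have "trace_exp t A (A - B) - trace_exp t B (A - B)
      = (\<Sum>i\<in>UNIV. \<Sum>j\<in>UNIV. ?E i * ((a i - b j) * C i j))
      - (\<Sum>j\<in>UNIV. \<Sum>i\<in>UNIV. ?G j * ((a i - b j) * C i j))"
    by (simp add: trA trB qu qw sum_distrib_left)
  also have "(\<Sum>j\<in>UNIV. \<Sum>i\<in>UNIV. ?G j * ((a i - b j) * C i j))
      = (\<Sum>i\<in>UNIV. \<Sum>j\<in>UNIV. ?G j * ((a i - b j) * C i j))"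
    by (rule sum.swap)
  also have "(\<Sum>i\<in>UNIV. \<Sum>j\<in>UNIV. ?E i * ((a i - b j) * C i j)) - \<dots>
      = (\<Sum>i\<in>UNIV. \<Sum>j\<in>UNIV. ((a i - b j) * (?E i - ?G j)) * C i j)"
    by (simp add: sum_subtractf[symmetric] algebra_simps)
  also have "\<dots> \<le> (\<Sum>i\<in>UNIV. \<Sum>j\<in>UNIV. (t / 2 * (a i - b j)\<^sup>2 * (?E i + ?G j)) * C i j)"
    by (intro sum_mono mult_right_mono exp_monotone_mean_bound assms(3)) (simp add: C_def)
  also have "\<dots> = (\<Sum>i\<in>UNIV. \<Sum>j\<in>UNIV. t / 2 * (?E i * ((a i - b j)\<^sup>2 * C i j)))
      + (\<Sum>i\<in>UNIV. \<Sum>j\<in>UNIV. t / 2 * (?G j * ((a i - b j)\<^sup>2 * C i j)))"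
    by (simp add: sum.distrib[symmetric] algebra_simps add_divide_distrib)
  also have "(\<Sum>i\<in>UNIV. \<Sum>j\<in>UNIV. t / 2 * (?G j * ((a i - b j)\<^sup>2 * C i j)))
      = (\<Sum>j\<in>UNIV. \<Sum>i\<in>UNIV. t / 2 * (?G j * ((a i - b j)\<^sup>2 * C i j)))"
    by (rule sum.swap)
  also have "(\<Sum>i\<in>UNIV. \<Sum>j\<in>UNIV. t / 2 * (?E i * ((a i - b j)\<^sup>2 * C i j))) + \<dots>
      = t / 2 * ((\<Sum>i\<in>UNIV. ?E i * (\<Sum>j\<in>UNIV. (a i - b j)\<^sup>2 * C i j))
        + (\<Sum>j\<in>UNIV. ?G j * (\<Sum>i\<in>UNIV. (a i - b j)\<^sup>2 * C i j)))"
    by (simp add: sum_distrib_left distrib_left)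
  also have "\<dots> \<le> t / 2 * ((\<Sum>i\<in>UNIV. ?E i * c\<^sup>2) + (\<Sum>j\<in>UNIV. ?G j * c\<^sup>2))"
    using nu nw assms(3) by (intro mult_left_mono add_mono sum_mono) auto
  also have "\<dots> = t / 2 * c\<^sup>2 * (trace_exp t A (mat 1) + trace_exp t B (mat 1))"
    by (simp add: trA trB ou ow sum_distrib_left sum_divide_distrib algebra_simps)
  finally show ?thesis .
qed

section \<open>Exchangeable samples and the Chernoff bound\<close>

text \<open>Swapping coordinate \<open>j\<close> with its fresh copy is an involution on pairs of a
  sample and an index. This is exchangeability, stated by counting.\<close>

lemma sum_resample_coordinate:
  fixes g :: "(nat \<Rightarrow> nat) \<Rightarrow> nat \<Rightarrow> real"
  assumes "j < m"
  shows "(\<Sum>S\<in>PiE_dflt {..<m} 0 (\<lambda>_. {..<n}). \<Sum>i<n. g (S(j := i)) (S j))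
    = (\<Sum>S\<in>PiE_dflt {..<m} 0 (\<lambda>_. {..<n}). \<Sum>i<n. g S i)"
proof -
  let ?O = "PiE_dflt {..<m} 0 (\<lambda>_. {..<n})"
  have "(\<Sum>(S, i)\<in>?O \<times> {..<n}. g (S(j := i)) (S j)) = (\<Sum>(S, i)\<in>?O \<times> {..<n}. g S i)"
    by (rule sum.reindex_bij_witness[of _ "\<lambda>(S, i). (S(j := i), S j)" "\<lambda>(S, i). (S(j := i), S j)"])
      (use assms in \<open>auto simp: PiE_dflt_def\<close>)
  then show ?thesis by (simp add: sum.cartesian_product)
qed

text \<open>Gronwall's argument with integrating factor
  \<open>exp (- (c * x\<^sup>2))\<close>.\<close>

lemma exp_quadratic_growth:
  fixes M :: "real \<Rightarrow> real"
  assumes "0 \<le> t" and der: "\<And>x. (M has_real_derivative M' x) (at x)"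
    and le: "\<And>x. 0 \<le> x \<Longrightarrow> M' x \<le> 2 * c * x * M x"
  shows "M t \<le> M 0 * exp (c * t\<^sup>2)"
proof -
  define g where "g x = M x * exp (- (c * x\<^sup>2))" for x
  have "g t \<le> g 0"
  proof (rule DERIV_nonpos_imp_nonincreasing[OF assms(1)], intro exI conjI)
    fix x :: real assume x: "0 \<le> x"
    show "(g has_real_derivative (M' x - 2 * c * x * M x) * exp (- (c * x\<^sup>2))) (at x)"
      unfolding g_def by (auto intro!: derivative_eq_intros der simp: algebra_simps)
    show "(M' x - 2 * c * x * M x) * exp (- (c * x\<^sup>2)) \<le> 0"
      using le[OF x] by (intro mult_nonpos_nonneg) auto
  qed
  then have "M t * exp (- (c * t\<^sup>2)) * exp (c * t\<^sup>2) \<le> M 0 * exp (c * t\<^sup>2)"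
    by (intro mult_right_mono) (auto simp: g_def)
  then show ?thesis by (simp add: mult.assoc exp_add[symmetric])
qed

text \<open>Left unscaled, so that resampling one index changes it by a plain difference of two of
  the matrices; the factor \<open>1 / m\<close> returns only in the final bound.\<close>

definition centered_sum :: "(nat \<Rightarrow> real^'p^'p) \<Rightarrow> nat \<Rightarrow> nat \<Rightarrow> (nat \<Rightarrow> nat) \<Rightarrow> real^'p^'p" where
  "centered_sum H n m S = (\<Sum>j<m. H (S j) - (1 / real n) *\<^sub>R (\<Sum>i<n. H i))"

context
  fixes H :: "nat \<Rightarrow> real^'p^'p" and n m :: nat and K :: real
  assumes n_pos: "0 < n"
    and H_sym: "\<And>i. i < n \<Longrightarrow> transpose (H i) = H i"
    and H_bound: "\<And>i x. i < n \<Longrightarrow> norm (H i *v x) \<le> K * norm x"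
begin

text \<open>Sums over this finite set are expectations up to the factor \<open>card samples\<close>;
  \<open>M t\<close> is thus the unnormalized trace moment generating function.\<close>

abbreviation (input) "samples \<equiv> PiE_dflt {..<m} 0 (\<lambda>_. {..<n})"
abbreviation (input) "X \<equiv> centered_sum H n m"
abbreviation (input) "M t \<equiv> (\<Sum>S\<in>samples. trace_exp t (X S) (mat 1))"

lemma centered_sum_symmetric:
  assumes "S \<in> samples"
  shows "transpose (X S) = X S"
  unfolding centered_sum_def
  by (intro symmetric_matrix_sum symmetric_matrix_diff symmetric_matrix_scaleR H_sym)
    (use assms in \<open>auto simp: PiE_dflt_def\<close>)

lemma centered_sum_diff:
  assumes "j < m"
  shows "X S - X (S(j := i)) = H (S j) - H i"
proof -
  have "X S - X (S(j := i)) = (\<Sum>k<m. if k = j then H (S j) - H i else 0)"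
    unfolding centered_sum_def sum_subtractf[symmetric] by (intro sum.cong) auto
  then show ?thesis using assms by simp
qed

text \<open>Exchangeable pairs: resampling one coordinate and swapping the two copies antisymmetrises
  the derivative, so only differences \<open>H i - H k\<close> of norm at most \<open>2 K\<close> enter.\<close>

lemma trace_mgf_derivative_bound:
  assumes "0 \<le> t"
  shows "(\<Sum>S\<in>samples. trace_exp t (X S) (X S)) \<le> 2 * (real m * K\<^sup>2) * t * M t"
proof -
  define g where "g j S i = trace_exp t (X S) (H (S j) - H i)" for j S i
  have pair: "(\<Sum>S\<in>samples. \<Sum>i<n. g j S i) \<le> 2 * t * K\<^sup>2 * n * M t" if j: "j < m" for j
  proof -
    have le: "g j S i + g j (S(j := i)) (S j)
        \<le> 2 * t * K\<^sup>2 * (trace_exp t (X S) (mat 1) + trace_exp t (X (S(j := i))) (mat 1))"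
      if S: "S \<in> samples" and i: "i < n" for S i
    proof -
      have S': "S(j := i) \<in> samples" using S i j by (auto simp: PiE_dflt_def)
      have Sj: "S j < n" using S j by (auto simp: PiE_dflt_def)
      have d: "X S - X (S(j := i)) = H (S j) - H i" by (rule centered_sum_diff[OF j])
      have "norm ((X S - X (S(j := i))) *v x) \<le> 2 * K * norm x" for x
        unfolding d matrix_vector_mult_diff_rdistrib
        using norm_triangle_ineq4[of "H (S j) *v x" "H i *v x"] H_bound[OF Sj, of x]
          H_bound[OF i, of x] by linarith
      from trace_exp_mean_value[OF centered_sum_symmetric[OF S] centered_sum_symmetric[OF S']
          assms this]
      show ?thesis by (simp add: d g_def trace_exp_diff power2_eq_square algebra_simps)
    qed
    \<comment> \<open>The swap turns \<open>H (S j) - H i\<close> into its negative and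
      \<open>X S\<close> into its resampled copy, so the symmetrized sum consists of differences to
      which the trace mean value inequality applies.\<close>
    have "2 * (\<Sum>S\<in>samples. \<Sum>i<n. g j S i)
        = (\<Sum>S\<in>samples. \<Sum>i<n. g j S i + g j (S(j := i)) (S j))"
      using sum_resample_coordinate[OF j, of "g j" n] by (simp add: sum.distrib)
    also have "\<dots> \<le> (\<Sum>S\<in>samples. \<Sum>i<n.
        2 * t * K\<^sup>2 * (trace_exp t (X S) (mat 1) + trace_exp t (X (S(j := i))) (mat 1)))"
      using le by (intro sum_mono) auto
    also have "\<dots> = 2 * t * K\<^sup>2 * ((\<Sum>S\<in>samples. \<Sum>i<n. trace_exp t (X S) (mat 1))
        + (\<Sum>S\<in>samples. \<Sum>i<n. trace_exp t (X (S(j := i))) (mat 1)))"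
      unfolding sum.distrib[symmetric] sum_distrib_left ..
    also have "(\<Sum>S\<in>samples. \<Sum>i<n. trace_exp t (X (S(j := i))) (mat 1))
        = (\<Sum>S\<in>samples. \<Sum>i<n. trace_exp t (X S) (mat 1))"
      by (rule sum_resample_coordinate[OF j, of "\<lambda>S i. trace_exp t (X S) (mat 1)"])
    also have "(\<Sum>S\<in>samples. \<Sum>i<n. trace_exp t (X S) (mat 1)) = n * M t"
      by (simp add: sum_distrib_left)
    finally show ?thesis by (simp add: mult.assoc mult.left_commute)
  qed
  \<comment> \<open>Averaging over the fresh index \<open>i\<close> turns \<open>H i\<close> into
    the mean matrix, so each summand of \<open>X S\<close> is an average of differences
    \<open>H (S j) - H i\<close>.\<close>
  have "trace_exp t (X S) (X S) = (\<Sum>j<m. (1 / n) * (\<Sum>i<n. g j S i))" for S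
  proof -
    have "trace_exp t (X S) (X S)
        = (\<Sum>j<m. trace_exp t (X S) (H (S j) - (1 / real n) *\<^sub>R (\<Sum>i<n. H i)))"
      by (subst (2) centered_sum_def) (rule trace_exp_sum)
    also have "\<dots> = (\<Sum>j<m. (1 / n) * (\<Sum>i<n. g j S i))"
      using n_pos by (intro sum.cong)
        (auto simp: g_def trace_exp_diff trace_exp_scaleR trace_exp_sum sum_subtractf field_simps)
    finally show ?thesis .
  qed
  then have "(\<Sum>S\<in>samples. trace_exp t (X S) (X S))
      = (\<Sum>j<m. \<Sum>S\<in>samples. (1 / n) * (\<Sum>i<n. g j S i))"
    by (simp add: sum.swap[of _ samples])
  also have "\<dots> = (\<Sum>j<m. (1 / n) * (\<Sum>S\<in>samples. \<Sum>i<n. g j S i))"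
    by (simp add: sum_distrib_left)
  also have "\<dots> \<le> (\<Sum>j<m. (1 / n) * (2 * t * K\<^sup>2 * n * M t))"
    using pair by (intro sum_mono mult_left_mono) auto
  also have "\<dots> = 2 * (real m * K\<^sup>2) * t * M t" using n_pos by simp
  finally show ?thesis .
qed

lemma trace_mgf_bound:
  assumes "0 \<le> t"
  shows "M t \<le> card samples * real CARD('p) * exp (real m * K\<^sup>2 * t\<^sup>2)"
proof -
  have "M t \<le> M 0 * exp (real m * K\<^sup>2 * t\<^sup>2)"
    by (rule exp_quadratic_growth[OF assms _ trace_mgf_derivative_bound])
      (auto intro!: derivative_eq_intros trace_exp_has_derivative centered_sum_symmetric)
  then show ?thesis by (simp add: trace_exp_zero centered_sum_symmetric)
qed

lemma matrix_hoeffding_upper: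
  fixes tau :: real
  assumes "0 < m" "0 < K" "0 \<le> tau"
  shows "real (card {S \<in> samples. \<exists>x. norm x = 1 \<and> m * tau < x \<bullet> (X S *v x)})
    \<le> card samples * real CARD('p) * exp (- (m * tau\<^sup>2) / (4 * K\<^sup>2))"
proof -
  \<comment> \<open>The minimizer of the exponent
    \<open>m * K\<^sup>2 * t\<^sup>2 - t * (m * tau)\<close>.\<close>
  define t where "t = tau / (2 * K\<^sup>2)"
  have t: "0 \<le> t" using assms by (simp add: t_def)
  define bad where "bad = {S \<in> samples. \<exists>x. norm x = 1 \<and> m * tau < x \<bullet> (X S *v x)}"
  have fin: "finite samples" by (intro finite_PiE_dflt) auto
  have ge: "exp (t * (m * tau)) \<le> trace_exp t (X S) (mat 1)" if "S \<in> bad" for S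
    using that unfolding bad_def
    by (auto intro: trace_exp_ge[OF centered_sum_symmetric t] less_imp_le)
  have pos: "0 \<le> trace_exp t (X S) (mat 1)" if "S \<in> samples" for S
  proof -
    obtain x :: "real^'p" where "norm x = 1" using vector_choose_size[of 1] by auto
    then show ?thesis
      using trace_exp_ge[OF centered_sum_symmetric[OF that] t, of x] exp_ge_zero order_trans by blast
  qed
  have "card bad * exp (t * (m * tau)) \<le> (\<Sum>S\<in>bad. trace_exp t (X S) (mat 1))"
    using sum_mono[of bad "\<lambda>_. exp (t * (m * tau))"] ge by simp
  also have "\<dots> \<le> M t" using fin pos by (intro sum_mono2) (auto simp: bad_def)
  also have "\<dots> \<le> card samples * real CARD('p) * exp (real m * K\<^sup>2 * t\<^sup>2)"
    by (rule trace_mgf_bound[OF t])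
  finally have "card bad * exp (t * (m * tau)) * exp (- (t * (m * tau)))
      \<le> card samples * real CARD('p) * exp (real m * K\<^sup>2 * t\<^sup>2) * exp (- (t * (m * tau)))"
    by (intro mult_right_mono) auto
  moreover have "real m * K\<^sup>2 * t\<^sup>2 - t * (m * tau) = - (m * tau\<^sup>2) / (4 * K\<^sup>2)"
    using assms by (simp add: t_def power2_eq_square field_simps)
  ultimately show ?thesis by (simp add: bad_def mult.assoc exp_add[symmetric])
qed

end

lemma centered_sum_uminus: "centered_sum (\<lambda>i. - H i) n m S = - centered_sum H n m S"
  by (simp add: centered_sum_def sum_negf sum_subtractf)

text \<open>A union bound over \<open>H\<close> and \<open>- H\<close>, each tail costing
  \<open>delta / 2\<close>. The event also records that the sampled indices are below
  \<open>n\<close>, on which symmetry and the Lipschitz bound of sub-sampled Hessians depend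
  later.\<close>

lemma matrix_hoeffding:
  fixes H :: "nat \<Rightarrow> real^'p^'p"
  assumes n: "0 < n" and sym: "\<And>i. i < n \<Longrightarrow> transpose (H i) = H i"
    and bound: "\<And>i x. i < n \<Longrightarrow> norm (H i *v x) \<le> K * norm x"
    and K: "0 < K" and tau: "0 < tau" and delta: "0 < delta" "delta < 1"
    and m: "4 * K\<^sup>2 * ln (2 * real CARD('p) / delta) / tau\<^sup>2 \<le> real m"
  shows "1 - delta \<le> measure_pmf.prob (sample_pmf n m)
    {S \<in> PiE_dflt {..<m} 0 (\<lambda>_. {..<n}). \<forall>x.
      norm (((1 / real m) *\<^sub>R (\<Sum>j<m. H (S j)) - (1 / real n) *\<^sub>R (\<Sum>i<n. H i)) *v x) \<le> tau * norm x}"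
    (is "_ \<le> measure_pmf.prob _ ?good")
proof -
  define samples where "samples = PiE_dflt {..<m} 0 (\<lambda>_::nat. {..<n})"
  have p: "1 \<le> real CARD('p)" by simp
  have "delta < 2 * real CARD('p)" using delta p by linarith
  then have "1 < 2 * real CARD('p) / delta" using delta by simp
  then have "0 < 4 * K\<^sup>2 * ln (2 * real CARD('p) / delta) / tau\<^sup>2"
    using K tau by (intro divide_pos_pos mult_pos_pos ln_gt_zero) auto
  \<comment> \<open>The logarithm is positive because \<open>delta < 1\<close>, so the size
    condition itself excludes an empty sample.\<close>
  with m have m_pos: "0 < m" by linarith
  have fin: "finite samples" unfolding samples_def by (intro finite_PiE_dflt) auto
  have ne: "samples \<noteq> {}" using n by (auto simp: samples_def)
  then have N: "0 < card samples" using fin by (simp add: card_gt_0_iff)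
  have tail: "real CARD('p) * exp (- (m * tau\<^sup>2) / (4 * K\<^sup>2)) \<le> delta / 2"
  proof -
    have "ln (2 * real CARD('p) / delta) \<le> m * tau\<^sup>2 / (4 * K\<^sup>2)"
      using m K tau by (simp add: field_simps)
    then have "exp (- (m * tau\<^sup>2) / (4 * K\<^sup>2)) \<le> exp (- ln (2 * real CARD('p) / delta))" by simp
    also have "\<dots> = delta / (2 * real CARD('p))" using delta by (simp add: exp_minus)
    finally show ?thesis using p by (simp add: field_simps)
  qed
  define up where "up H = {S \<in> samples. \<exists>x. norm x = 1 \<and> m * tau < x \<bullet> (centered_sum H n m S *v x)}"
    for H :: "nat \<Rightarrow> real^'p^'p"
  have up: "real (card (up H)) \<le> card samples * (delta / 2)"
    if "\<And>i. i < n \<Longrightarrow> transpose (H i) = H i"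
      "\<And>i x. i < n \<Longrightarrow> norm (H i *v x) \<le> K * norm x" for H :: "nat \<Rightarrow> real^'p^'p"
  proof -
    have "real (card (up H)) \<le> card samples * real CARD('p) * exp (- (m * tau\<^sup>2) / (4 * K\<^sup>2))"
      unfolding up_def samples_def
      by (rule matrix_hoeffding_upper[OF n that m_pos K]) (use tau in simp_all)
    also have "\<dots> \<le> card samples * (delta / 2)"
      unfolding mult.assoc by (intro mult_left_mono tail) simp
    finally show ?thesis .
  qed
  have neg: "(- A) *v x = - (A *v x)" for A :: "real^'p^'p" and x
    using matrix_vector_mult_diff_rdistrib[of 0 A x] by simp
  have "transpose (- H i) = - H i" if "i < n" for i
    using sym[OF that] by (simp add: transpose_def vec_eq_iff)
  moreover have "norm ((- H i) *v x) \<le> K * norm x" if "i < n" for i x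
    using bound[OF that] by (simp add: neg)
  ultimately have up2: "real (card (up (\<lambda>i. - H i))) \<le> card samples * (delta / 2)" by (intro up)
  have good: "norm (((1 / real m) *\<^sub>R (\<Sum>j<m. H (S j)) - (1 / real n) *\<^sub>R (\<Sum>i<n. H i)) *v x)
      \<le> tau * norm x" if S: "S \<in> samples - up H - up (\<lambda>i. - H i)" for S x
  proof -
    let ?X = "centered_sum H n m S"
    have symX: "transpose ?X = ?X"
      using centered_sum_symmetric[OF n sym bound] S by (simp add: samples_def)
    have "\<bar>x \<bullet> (?X *v x)\<bar> \<le> m * tau" if "norm x = 1" for x
      using S that by (auto simp: up_def centered_sum_uminus neg not_less abs_le_iff)
    then have le: "norm (?X *v x) \<le> m * tau * norm x" by (rule symmetric_norm_le[OF symX])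
    have "(1 / real m) *\<^sub>R (\<Sum>j<m. H (S j)) - (1 / real n) *\<^sub>R (\<Sum>i<n. H i) = (1 / real m) *\<^sub>R ?X"
      using m_pos by (simp add: centered_sum_def sum_subtractf scaleR_diff_right
          sum_constant_scaleR del: sum_constant)
    then show ?thesis using le m_pos
      by (simp add: scaleR_matrix_vector_assoc[symmetric] field_simps)
  qed
  have "real (card samples) - real (card (up H)) - real (card (up (\<lambda>i. - H i)))
      \<le> card (samples - up H - up (\<lambda>i. - H i))"
    using diff_card_le_card_Diff[of "up H" samples]
      diff_card_le_card_Diff[of "up (\<lambda>i. - H i)" "samples - up H"] fin
    by (auto simp: up_def)
  moreover have "card (samples - up H - up (\<lambda>i. - H i)) \<le> card ?good"
    using good fin by (intro of_nat_mono card_mono) (auto simp: samples_def)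
  moreover have "real (card (up H)) \<le> card samples * (delta / 2)" by (rule up[OF sym bound])
  ultimately have "card samples * (1 - delta) \<le> card ?good"
    using up2 by (simp add: right_diff_distrib)
  then have "1 - delta \<le> card ?good / card samples" using N by (simp add: field_simps)
  also have "\<dots> = measure_pmf.prob (sample_pmf n m) ?good"
  proof -
    have "sample_pmf n m = pmf_of_set samples"
      unfolding sample_pmf_def samples_def using n by (intro Pi_pmf_of_set) auto
    moreover have "samples \<inter> ?good = ?good" by (auto simp: samples_def)
    ultimately show ?thesis using measure_pmf_of_set[OF ne fin, of ?good] by simp
  qed
  finally show ?thesis .
qed

text \<open>Independence across iterations and within each pair makes the probability a product of
  \<open>2 * k0\<close> factors. Finiteness of the events supplies the countability that the product
  rule for pairs asks for.\<close>

lemma prob_independent_sample_pairs_ge: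
  fixes n k0 :: nat and m0 m :: "nat \<Rightarrow> nat"
  assumes delta: "0 < delta" "delta < 1"
    and A: "\<And>k. k < k0 \<Longrightarrow> 1 - delta \<le> measure_pmf.prob (sample_pmf n (m0 k)) (A k)"
    and B: "\<And>k. k < k0 \<Longrightarrow> 1 - delta \<le> measure_pmf.prob (sample_pmf n (m k)) (B k)"
    and fin: "\<And>k. finite (A k)" "\<And>k. finite (B k)"
  shows "(1 - delta) ^ (2 * k0)
    \<le> measure_pmf.prob (alg3_samples_pmf n k0 m0 m) {\<omega>. \<forall>k<k0. fst (\<omega> k) \<in> A k \<and> snd (\<omega> k) \<in> B k}"
proof -
  have "(1 - delta) ^ (2 * k0) = (\<Prod>k<k0. (1 - delta) * (1 - delta))"
    by (simp add: power_mult power2_eq_square)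
  also have "\<dots> \<le> (\<Prod>k<k0. measure_pmf.prob (pair_pmf (sample_pmf n (m0 k)) (sample_pmf n (m k)))
      (A k \<times> B k))"
  proof (intro prod_mono conjI)
    fix k assume "k \<in> {..<k0}"
    then show "(1 - delta) * (1 - delta)
        \<le> measure_pmf.prob (pair_pmf (sample_pmf n (m0 k)) (sample_pmf n (m k))) (A k \<times> B k)"
      using A[of k] B[of k] delta fin
      by (subst measure_pmf_prob_product) (auto intro!: mult_mono countable_finite)
  qed (use delta in auto)
  also have "\<dots> = measure_pmf.prob (alg3_samples_pmf n k0 m0 m) (Pi {..<k0} (\<lambda>k. A k \<times> B k))"
    unfolding alg3_samples_pmf_def by (subst measure_Pi_pmf_Pi) auto
  also have "Pi {..<k0} (\<lambda>k. A k \<times> B k) = {\<omega>. \<forall>k<k0. fst (\<omega> k) \<in> A k \<and> snd (\<omega> k) \<in> B k}"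
    by (auto simp: Pi_def mem_Times_iff)
  finally show ?thesis .
qed

subsection \<open>Second derivatives and optimality conditions\<close>

text \<open>The mean value theorem in direction \<open>u\<close>, applied to an increment in
  direction \<open>w\<close>, reduces the second difference to an increment of \<open>g\<close>.
  Differentiability of \<open>g\<close> at the single point \<open>x\<close> then suffices.\<close>

lemma second_difference_bound:
  fixes f :: "real^'p \<Rightarrow> real" and g :: "real^'p \<Rightarrow> real^'p" and A :: "real^'p^'p"
  assumes D: "open D" "x \<in> D"
    and f: "\<And>y. y \<in> D \<Longrightarrow> (f has_derivative (\<lambda>h. g y \<bullet> h)) (at y)"
    and g: "(g has_derivative (\<lambda>h. A *v h)) (at x)"
    and e: "0 < e"
  shows "\<exists>d>0. \<forall>t. 0 < t \<and> t < d \<longrightarrow>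
    \<bar>f (x + t *\<^sub>R u + t *\<^sub>R w) - f (x + t *\<^sub>R u) - f (x + t *\<^sub>R w) + f x - t\<^sup>2 * ((A *v w) \<bullet> u)\<bar>
    \<le> 2 * e * (norm u + norm w) * norm u * t\<^sup>2"
proof -
  define N where "N = norm u + norm w"
  obtain r where r: "0 < r" "ball x r \<subseteq> D" using D openE by blast
  obtain d1 where d1: "0 < d1"
    "\<And>y. norm (y - x) < d1 \<Longrightarrow> norm (g y - g x - A *v (y - x)) \<le> e * norm (y - x)"
    using g e unfolding has_derivative_at_alt by blast
  \<comment> \<open>Keeps all points of the parallelogram in \<open>D\<close> and in the range of
    the linear approximation; the 1 avoids a zero denominator.\<close>
  define d where "d = min r d1 / (N + 1)"
  have N: "0 \<le> N" by (simp add: N_def)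
  have d: "0 < d" using r d1 N by (simp add: d_def)
  have main: "\<bar>f (x + t *\<^sub>R u + t *\<^sub>R w) - f (x + t *\<^sub>R u) - f (x + t *\<^sub>R w) + f x - t\<^sup>2 * ((A *v w) \<bullet> u)\<bar>
    \<le> 2 * e * N * norm u * t\<^sup>2" if t: "0 < t" "t < d" for t
  proof -
    have tN: "t * N < min r d1"
    proof -
      have "t * N \<le> t * (N + 1)" using t by simp
      also have "\<dots> < d * (N + 1)" using t N by (intro mult_strict_right_mono) auto
      finally show ?thesis using N by (simp add: d_def)
    qed
    have small: "norm (s *\<^sub>R u + c *\<^sub>R w) \<le> t * N" if "0 \<le> s" "s \<le> t" "0 \<le> c" "c \<le> t" for s c
    proof -
      have "norm (s *\<^sub>R u + c *\<^sub>R w) \<le> s * norm u + c * norm w"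
        using norm_triangle_ineq[of "s *\<^sub>R u" "c *\<^sub>R w"] that by simp
      also have "\<dots> \<le> t * norm u + t * norm w" using that by (intro add_mono mult_right_mono) auto
      finally show ?thesis by (simp add: N_def distrib_left)
    qed
    have inD: "x + s *\<^sub>R u + c *\<^sub>R w \<in> D" if "0 \<le> s" "s \<le> t" "0 \<le> c" "c \<le> t" for s c
      using small[OF that] tN r(2) by (auto simp: subset_iff dist_norm norm_minus_commute add.assoc)
    define q where "q s = f (x + s *\<^sub>R u + t *\<^sub>R w) - f (x + s *\<^sub>R u)" for s
    have "\<exists>s\<in>{0<..<t}. q t - q 0 = (\<lambda>h. (g (x + s *\<^sub>R u + t *\<^sub>R w) - g (x + s *\<^sub>R u)) \<bullet> (h *\<^sub>R u)) (t - 0)"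
    proof (rule mvt_simple[OF t(1)])
      fix s assume s: "0 \<le> s" "s \<le> t"
      have 1: "((\<lambda>s. f (x + s *\<^sub>R u + t *\<^sub>R w)) has_derivative
          (\<lambda>h. g (x + s *\<^sub>R u + t *\<^sub>R w) \<bullet> (h *\<^sub>R u))) (at s within {0..t})"
        by (rule has_derivative_compose[of "\<lambda>s. x + s *\<^sub>R u + t *\<^sub>R w" "\<lambda>h. h *\<^sub>R u", OF _ f])
          (use s t inD[of s t] in \<open>auto intro!: derivative_eq_intros\<close>)
      have 2: "((\<lambda>s. f (x + s *\<^sub>R u)) has_derivative
          (\<lambda>h. g (x + s *\<^sub>R u) \<bullet> (h *\<^sub>R u))) (at s within {0..t})"
        by (rule has_derivative_compose[of "\<lambda>s. x + s *\<^sub>R u" "\<lambda>h. h *\<^sub>R u", OF _ f])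
          (use s t inD[of s 0] in \<open>auto intro!: derivative_eq_intros\<close>)
      show "(q has_derivative (\<lambda>h. (g (x + s *\<^sub>R u + t *\<^sub>R w) - g (x + s *\<^sub>R u)) \<bullet> (h *\<^sub>R u)))
          (at s within {0..t})"
        unfolding q_def using has_derivative_diff[OF 1 2] by (simp add: inner_diff_left right_diff_distrib)
    qed
    then obtain s where s: "0 < s" "s < t"
      and q: "q t - q 0 = t * ((g (x + s *\<^sub>R u + t *\<^sub>R w) - g (x + s *\<^sub>R u)) \<bullet> u)" by auto
    define R where "R y = g y - g x - A *v (y - x)" for y
    have R: "norm (R (x + s *\<^sub>R u + c *\<^sub>R w)) \<le> e * (t * N)" if c: "0 \<le> c" "c \<le> t" for c
    proof -
      have le: "norm (x + s *\<^sub>R u + c *\<^sub>R w - x) \<le> t * N"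
        using small[of s c] s c by (simp add: add.assoc)
      then have "norm (R (x + s *\<^sub>R u + c *\<^sub>R w)) \<le> e * norm (x + s *\<^sub>R u + c *\<^sub>R w - x)"
        unfolding R_def using tN by (intro d1(2)) auto
      also have "\<dots> \<le> e * (t * N)" using le e by (intro mult_left_mono) auto
      finally show ?thesis .
    qed
    have "g (x + s *\<^sub>R u + t *\<^sub>R w) - g (x + s *\<^sub>R u)
        = t *\<^sub>R (A *v w) + (R (x + s *\<^sub>R u + t *\<^sub>R w) - R (x + s *\<^sub>R u))"
      by (simp add: R_def matrix_vector_right_distrib matrix_vector_mult_scaleR
          matrix_vector_mult_diff_distrib)
    then have "(g (x + s *\<^sub>R u + t *\<^sub>R w) - g (x + s *\<^sub>R u)) \<bullet> u
        = t * ((A *v w) \<bullet> u) + (R (x + s *\<^sub>R u + t *\<^sub>R w) - R (x + s *\<^sub>R u)) \<bullet> u"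
      by (simp only: inner_add_left inner_scaleR_left)
    then have "q t - q 0 - t\<^sup>2 * ((A *v w) \<bullet> u)
        = t * ((R (x + s *\<^sub>R u + t *\<^sub>R w) - R (x + s *\<^sub>R u)) \<bullet> u)"
      unfolding q by (simp only: distrib_left) (simp add: power2_eq_square)
    moreover have "\<bar>(R (x + s *\<^sub>R u + t *\<^sub>R w) - R (x + s *\<^sub>R u)) \<bullet> u\<bar> \<le> (2 * (e * (t * N))) * norm u"
    proof -
      have "\<bar>(R (x + s *\<^sub>R u + t *\<^sub>R w) - R (x + s *\<^sub>R u)) \<bullet> u\<bar>
          \<le> norm (R (x + s *\<^sub>R u + t *\<^sub>R w) - R (x + s *\<^sub>R u)) * norm u"
        by (rule Cauchy_Schwarz_ineq2)
      also have "\<dots> \<le> (2 * (e * (t * N))) * norm u"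
        using R[of t] R[of 0] t
          norm_triangle_ineq4[of "R (x + s *\<^sub>R u + t *\<^sub>R w)" "R (x + s *\<^sub>R u)"]
        by (intro mult_right_mono) auto
      finally show ?thesis .
    qed
    ultimately have "\<bar>q t - q 0 - t\<^sup>2 * ((A *v w) \<bullet> u)\<bar> \<le> t * ((2 * (e * (t * N))) * norm u)"
      using t by (simp add: abs_mult)
    then show ?thesis by (simp add: q_def power2_eq_square algebra_simps)
  qed
  then show ?thesis using d unfolding N_def by blast
qed

text \<open>The second difference does not change when \<open>u\<close> and \<open>w\<close> are
  exchanged, so its two leading coefficients agree up to every positive error.\<close>

lemma hessian_symmetric:
  fixes f :: "real^'p \<Rightarrow> real" and g :: "real^'p \<Rightarrow> real^'p" and A :: "real^'p^'p"
  assumes D: "open D" "x \<in> D"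
    and f: "\<And>y. y \<in> D \<Longrightarrow> (f has_derivative (\<lambda>h. g y \<bullet> h)) (at y)"
    and g: "(g has_derivative (\<lambda>h. A *v h)) (at x)"
  shows "transpose A = A"
proof -
  have "(A *v w) \<bullet> u = (A *v u) \<bullet> w" for u w
  proof -
    \<comment> \<open>The two errors add up to a multiple of
      \<open>2 * (norm u + norm w)\<^sup>2\<close>; the 1 keeps \<open>c\<close> positive when both
      vectors vanish.\<close>
    define c where "c = 2 * (norm u + norm w)\<^sup>2 + 1"
    have c: "0 < c" by (simp add: c_def add_nonneg_pos)
    have le: "\<bar>(A *v w) \<bullet> u - (A *v u) \<bullet> w\<bar> \<le> e" if e: "0 < e" for e
    proof -
      have ec: "0 < e / c" using e c by simp
      let ?D = "\<lambda>t u w. f (x + t *\<^sub>R u + t *\<^sub>R w) - f (x + t *\<^sub>R u) - f (x + t *\<^sub>R w) + f x"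
      obtain d1 where d1: "0 < d1" "\<And>t. 0 < t \<Longrightarrow> t < d1 \<Longrightarrow>
          \<bar>?D t u w - t\<^sup>2 * ((A *v w) \<bullet> u)\<bar> \<le> 2 * (e / c) * (norm u + norm w) * norm u * t\<^sup>2"
        using second_difference_bound[OF D f g ec, of u w] by blast
      obtain d2 where d2: "0 < d2" "\<And>t. 0 < t \<Longrightarrow> t < d2 \<Longrightarrow>
          \<bar>?D t w u - t\<^sup>2 * ((A *v u) \<bullet> w)\<bar> \<le> 2 * (e / c) * (norm w + norm u) * norm w * t\<^sup>2"
        using second_difference_bound[OF D f g ec, of w u] by blast
      define t where "t = min d1 d2 / 2"
      have t: "0 < t" "t < d1" "t < d2" using d1(1) d2(1) by (auto simp: t_def)
      have "?D t w u = ?D t u w" by (simp add: add.assoc add.commute[of "t *\<^sub>R u"])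
      then have "\<bar>t\<^sup>2 * ((A *v w) \<bullet> u) - t\<^sup>2 * ((A *v u) \<bullet> w)\<bar>
          \<le> 2 * (e / c) * (norm u + norm w) * norm u * t\<^sup>2 + 2 * (e / c) * (norm w + norm u) * norm w * t\<^sup>2"
        using d1(2)[OF t(1,2)] d2(2)[OF t(1,3)] by linarith
      also have "\<dots> = t\<^sup>2 * ((e / c) * (2 * (norm u + norm w)\<^sup>2))"
        by (simp add: power2_eq_square distrib_left distrib_right add_divide_distrib mult_ac)
      also have "\<dots> \<le> t\<^sup>2 * ((e / c) * c)"
        using ec by (intro mult_left_mono) (auto simp: c_def)
      finally have "t\<^sup>2 * \<bar>(A *v w) \<bullet> u - (A *v u) \<bullet> w\<bar> \<le> t\<^sup>2 * e"
        using c by (simp add: right_diff_distrib[symmetric] abs_mult)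
      then show ?thesis using t by simp
    qed
    have "\<bar>(A *v w) \<bullet> u - (A *v u) \<bullet> w\<bar> \<le> 0"
      by (rule field_le_epsilon) (use le in auto)
    then show ?thesis by simp
  qed
  from this[of "axis _ 1" "axis _ 1"] have "A $ i $ j = A $ j $ i" for i j
    by (simp add: matrix_vector_mult_basis inner_axis column_def)
  then show ?thesis by (simp add: transpose_def vec_eq_iff)
qed

text \<open>Along the segment the Hessian deviates by at most \<open>L * t * norm d\<close>, and
  integrating \<open>t\<close> gives the 1/2 that accompanies \<open>sqrt p\<close> in the radius.
  Monotonicity of \<open>q\<close> stands in for the integral, so the Hessian need not be
  integrable.\<close>

lemma gradient_increment_bound:
  fixes g :: "real^'p \<Rightarrow> real^'p" and Hs :: "real^'p \<Rightarrow> real^'p^'p"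
  assumes C: "convex C" "x \<in> C" "xs \<in> C"
    and g: "\<And>y. y \<in> C \<Longrightarrow> (g has_derivative (\<lambda>h. Hs y *v h)) (at y)"
    and lip: "\<And>y v. y \<in> C \<Longrightarrow> norm ((Hs y - Hs xs) *v v) \<le> L * norm (y - xs) * norm v"
  shows "(g x - g xs - Hs xs *v (x - xs)) \<bullet> w \<le> L / 2 * (norm (x - xs))\<^sup>2 * norm w"
proof -
  define d where "d = x - xs"
  define q where "q t = g (xs + t *\<^sub>R d) \<bullet> w - t * ((Hs xs *v d) \<bullet> w) - L / 2 * t\<^sup>2 * (norm d)\<^sup>2 * norm w" for t
  have "q 1 \<le> q 0"
  proof (rule DERIV_nonpos_imp_nonincreasing, simp, intro exI conjI)
    fix t :: real assume t: "0 \<le> t" "t \<le> 1"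
    have inC: "xs + t *\<^sub>R d \<in> C"
      using convexD_alt[OF C(1,3,2), of t] t by (simp add: d_def algebra_simps)
    have "((\<lambda>t. g (xs + t *\<^sub>R d)) has_derivative (\<lambda>h. Hs (xs + t *\<^sub>R d) *v (h *\<^sub>R d))) (at t)"
      by (rule has_derivative_compose[of "\<lambda>t. xs + t *\<^sub>R d" "\<lambda>h. h *\<^sub>R d", OF _ g[OF inC]])
        (auto intro!: derivative_eq_intros)
    from has_derivative_inner_left[OF this, of w]
    have "((\<lambda>t. g (xs + t *\<^sub>R d) \<bullet> w) has_real_derivative (Hs (xs + t *\<^sub>R d) *v d) \<bullet> w) (at t)"
      by (simp add: has_field_derivative_def matrix_vector_mult_scaleR mult.commute[of _ "_ \<bullet> _"])
    then show "(q has_real_derivative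
        (Hs (xs + t *\<^sub>R d) *v d) \<bullet> w - (Hs xs *v d) \<bullet> w - L * t * (norm d)\<^sup>2 * norm w) (at t)"
      unfolding q_def by (auto intro!: derivative_eq_intros)
    have "(Hs (xs + t *\<^sub>R d) *v d) \<bullet> w - (Hs xs *v d) \<bullet> w
        = ((Hs (xs + t *\<^sub>R d) - Hs xs) *v d) \<bullet> w"
      by (simp add: matrix_vector_mult_diff_rdistrib inner_diff_left)
    also have "\<dots> \<le> norm ((Hs (xs + t *\<^sub>R d) - Hs xs) *v d) * norm w"
      by (rule norm_cauchy_schwarz)
    also have "\<dots> \<le> (L * norm (t *\<^sub>R d) * norm d) * norm w"
      using lip[OF inC, of d] by (intro mult_right_mono) auto
    finally show "(Hs (xs + t *\<^sub>R d) *v d) \<bullet> w - (Hs xs *v d) \<bullet> w - L * t * (norm d)\<^sup>2 * norm w \<le> 0"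
      using t by (simp add: power2_eq_square mult_ac)
  qed
  then show ?thesis by (simp add: q_def d_def inner_diff_left)
qed

section \<open>Variational inequalities and the contraction of one step\<close>

lemma quad_model_minimizer_variational:
  fixes M :: "real^'p^'p"
  assumes C: "convex C" "z \<in> C" "y \<in> C"
    and M: "\<And>u v. (M *v u) \<bullet> v = u \<bullet> (M *v v)"
    and min: "\<And>y. y \<in> C \<Longrightarrow> quad_model c x g M z \<le> quad_model c x g M y"
  shows "0 \<le> (g + M *v (z - x)) \<bullet> (y - z)"
proof (rule nonneg_if_quadratic_nonneg_near_zero)
  fix t :: real assume t: "0 < t" "t \<le> 1"
  have "z + t *\<^sub>R (y - z) \<in> C"
    using convexD_alt[OF C, of t] t by (simp add: algebra_simps)
  from min[OF this] have le: "quad_model c x g M z \<le> quad_model c x g M (z + t *\<^sub>R (y - z))" .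
  define a b where "a = z - x" and "b = y - z"
  have e: "z + t *\<^sub>R b - x = a + t *\<^sub>R b" by (simp add: a_def)
  have "b \<bullet> (M *v a) = a \<bullet> (M *v b)" using M[of a b] by (simp add: inner_commute)
  then have "(a + t *\<^sub>R b) \<bullet> (M *v (a + t *\<^sub>R b))
      = a \<bullet> (M *v a) + 2 * t * (a \<bullet> (M *v b)) + t\<^sup>2 * (b \<bullet> (M *v b))"
    by (simp add: matrix_vector_right_distrib matrix_vector_mult_scaleR inner_add_left
        inner_add_right power2_eq_square algebra_simps)
  then have "0 \<le> (g \<bullet> b + a \<bullet> (M *v b)) * t + (1 / 2 * (b \<bullet> (M *v b))) * t\<^sup>2"
    using le unfolding quad_model_def a_def[symmetric] b_def[symmetric] e
    by (simp add: inner_add_left inner_commute algebra_simps)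
  then show "0 \<le> (g + M *v (z - x)) \<bullet> (y - z) * t + (1 / 2 * (b \<bullet> (M *v b))) * t\<^sup>2"
    by (simp add: inner_add_left M a_def b_def)
qed

lemma local_min_variational:
  fixes F :: "'a::real_inner \<Rightarrow> real"
  assumes C: "convex C" "xs \<in> C" "y \<in> C"
    and F: "(F has_derivative (\<lambda>h. G \<bullet> h)) (at xs)"
    and min: "0 < e" "\<And>x. x \<in> C \<Longrightarrow> dist x xs < e \<Longrightarrow> F xs \<le> F x"
  shows "0 \<le> G \<bullet> (y - xs)"
proof (rule ccontr)
  assume "\<not> ?thesis"
  then have neg: "G \<bullet> (y - xs) < 0" by simp
  define d where "d = y - xs"
  have F': "(F has_derivative (\<lambda>h. G \<bullet> h)) (at (xs + 0 *\<^sub>R d))" using F by simp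
  have "((\<lambda>t. F (xs + t *\<^sub>R d)) has_derivative (\<lambda>h. G \<bullet> (h *\<^sub>R d))) (at 0)"
    by (rule has_derivative_compose[of "\<lambda>t. xs + t *\<^sub>R d" "\<lambda>h. h *\<^sub>R d", OF _ F'])
      (auto intro!: derivative_eq_intros)
  then have "((\<lambda>t. F (xs + t *\<^sub>R d)) has_real_derivative G \<bullet> d) (at 0)"
    by (simp add: has_field_derivative_def mult.commute[of _ "_ \<bullet> _"])
  from DERIV_neg_dec_right[OF this] neg obtain r where r: "0 < r"
    "\<And>h. 0 < h \<Longrightarrow> h < r \<Longrightarrow> F (xs + h *\<^sub>R d) < F xs" by (auto simp: d_def)
  \<comment> \<open>Small enough to stay on the segment, in the range where \<open>F\<close>
    decreases, and within \<open>e\<close> of \<open>xs\<close>.\<close>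
  define t where "t = min (min 1 (r / 2)) (e / (2 * (norm d + 1)))"
  have t: "0 < t" "t \<le> 1" "t < r" using r(1) min(1) by (auto simp: t_def add_nonneg_pos)
  have "xs + t *\<^sub>R d \<in> C"
    using convexD_alt[OF C, of t] t by (simp add: d_def algebra_simps)
  moreover have "dist (xs + t *\<^sub>R d) xs < e"
  proof -
    have "t * norm d \<le> t * (norm d + 1)" using t by simp
    also have "\<dots> \<le> e / (2 * (norm d + 1)) * (norm d + 1)"
      by (intro mult_right_mono) (auto simp: t_def)
    also have "\<dots> = e / 2" by (simp add: field_simps add_nonneg_eq_0_iff)
    finally show ?thesis using t min(1) by (simp add: dist_norm)
  qed
  ultimately show False using min(2) r(2)[OF t(1,3)] by (meson not_le)
qed

text \<open>The deterministic core: \<open>B\<close> and \<open>Bs\<close> stand for the sub-sampled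
  Hessians at the current point and at the minimizer. The comparison passes through the
  regularization of \<open>Bs\<close>, because its shift is governed by an eigenvalue within
  \<open>tau\<close> of \<open>gamma\<close>.\<close>

lemma regularized_newton_step:
  fixes g :: "real^'p \<Rightarrow> real^'p" and Hs :: "real^'p \<Rightarrow> real^'p^'p" and B Bs :: "real^'p^'p"
    and x xs z :: "real^'p"
  defines "gamma \<equiv> lambda_min (Hs xs)"
  assumes C: "convex C" "x \<in> C" "xs \<in> C" "z \<in> C"
    and g: "\<And>y. y \<in> C \<Longrightarrow> (g has_derivative (\<lambda>h. Hs y *v h)) (at y)"
    and lip: "\<And>y v. y \<in> C \<Longrightarrow> norm ((Hs y - Hs xs) *v v) \<le> L * norm (y - xs) * norm v"
    and first_order: "0 \<le> g xs \<bullet> (z - xs)"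
    and sym: "transpose (Hs xs) = Hs xs" "transpose B = B" "transpose Bs = Bs"
    and lipB: "\<And>v. norm ((B - Bs) *v v) \<le> L * norm (x - xs) * norm v"
    and tau: "\<And>v. norm ((Bs - Hs xs) *v v) \<le> tau * norm v" "tau \<le> gamma / 12"
    and min: "\<And>y. y \<in> C \<Longrightarrow>
      quad_model c x (g x) (spec_reg lam B) z \<le> quad_model c x (g x) (spec_reg lam B) y"
    and gamma: "0 < gamma"
    and close: "(sqrt (real CARD('p)) + 1/2) * L * norm (x - xs) \<le> gamma / 6"
    and lam: "5 / 6 * gamma < lam"
  shows "norm (z - xs) \<le> (1 - gamma / (2 * lam)) * norm (x - xs)"
proof -
  define d dz where "d = x - xs" and "dz = z - xs"
  define P where "P = spec_reg lam B"
  define mu where "mu = lambda_min Bs"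
  have lam_pos: "0 < lam" using gamma lam by linarith
  have "gamma - tau \<le> mu"
    unfolding gamma_def mu_def by (rule lambda_min_perturbation[OF sym(3,1) tau(1)])
  \<comment> \<open>If the shift is positive, the left side is at most
    \<open>lam - gamma + gamma / 6 + 2 * tau\<close>, hence at most
    \<open>lam - 2 / 3 * gamma\<close>. If it vanishes, the left side is at most
    \<open>gamma / 4\<close>, and \<open>lam > 5 / 6 * gamma\<close> is enough.\<close>
  then have coef: "sqrt (real CARD('p)) * (L * norm d) + max 0 (lam - mu) + tau + L / 2 * norm d
      \<le> lam - gamma / 2"
    using close tau(2) lam gamma by (auto simp: max_def d_def algebra_simps)
  have "norm ((P - Hs xs) *v d) \<le> (sqrt (real CARD('p)) * (L * norm d) + max 0 (lam - mu) + tau) * norm d"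
  proof -
    have "(P - Hs xs) *v d = (P - spec_reg lam Bs) *v d + (spec_reg lam Bs - Bs) *v d + (Bs - Hs xs) *v d"
      by (simp add: matrix_vector_mult_diff_rdistrib)
    also have "norm \<dots> \<le> norm ((P - spec_reg lam Bs) *v d) + norm ((spec_reg lam Bs - Bs) *v d)
        + norm ((Bs - Hs xs) *v d)"
      by (intro order_trans[OF norm_triangle_ineq] add_mono norm_triangle_ineq order_refl)
    also have "\<dots> \<le> sqrt (real CARD('p)) * (L * norm d) * norm d + max 0 (lam - mu) * norm d + tau * norm d"
      unfolding P_def mu_def d_def
      by (intro add_mono spec_reg_lipschitz sym lipB spec_reg_perturbation tau(1))
    finally show ?thesis by (simp add: algebra_simps)
  qed
  then have PH: "((P - Hs xs) *v d) \<bullet> dz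
      \<le> (sqrt (real CARD('p)) * (L * norm d) + max 0 (lam - mu) + tau) * norm d * norm dz"
    by (meson norm_cauchy_schwarz mult_right_mono norm_ge_zero order_trans)
  have "0 \<le> (g x + P *v (z - x)) \<bullet> (xs - z)"
    unfolding P_def
    by (rule quad_model_minimizer_variational[OF C(1,4,3) spec_reg_selfadjoint[OF sym(2)] min])
  moreover have "z - x = dz - d" "xs - z = - dz" by (simp_all add: d_def dz_def)
  ultimately have "(P *v dz) \<bullet> dz \<le> (P *v d) \<bullet> dz - g x \<bullet> dz"
    by (simp add: matrix_vector_mult_diff_distrib inner_add_left inner_diff_left algebra_simps)
  \<comment> \<open>At a constrained minimum the gradient need not vanish; its sign against
    \<open>dz\<close> is enough.\<close>
  also have "\<dots> \<le> (P *v d) \<bullet> dz - g x \<bullet> dz + g xs \<bullet> dz" using first_order by (simp add: dz_def)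
  also have "\<dots> = ((P - Hs xs) *v d) \<bullet> dz + (g x - g xs - Hs xs *v d) \<bullet> (- dz)"
    by (simp add: matrix_vector_mult_diff_rdistrib inner_diff_left)
  also have "\<dots> \<le> (sqrt (real CARD('p)) * (L * norm d) + max 0 (lam - mu) + tau) * norm d * norm dz
      + L / 2 * (norm d)\<^sup>2 * norm (- dz)"
    unfolding d_def by (intro add_mono PH[unfolded d_def] gradient_increment_bound[OF C(1-3) g lip])
  also have "\<dots> = (sqrt (real CARD('p)) * (L * norm d) + max 0 (lam - mu) + tau + L / 2 * norm d)
      * (norm d * norm dz)"
    by (simp add: power2_eq_square algebra_simps)
  also have "\<dots> \<le> (lam - gamma / 2) * (norm d * norm dz)"
    by (intro mult_right_mono coef) auto
  finally have "lam * (norm dz)\<^sup>2 \<le> (lam - gamma / 2) * (norm d * norm dz)"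
    using spec_reg_quadratic_form_ge[OF sym(2), of lam dz] by (simp add: P_def inner_commute)
  then have "(lam * norm dz) * norm dz \<le> ((lam - gamma / 2) * norm d) * norm dz"
    by (simp add: power2_eq_square mult.assoc)
  \<comment> \<open>Division by \<open>norm dz\<close>; at \<open>dz = 0\<close> the right side is
    still nonnegative because \<open>lam\<close> exceeds \<open>gamma / 2\<close>.\<close>
  then have "lam * norm dz \<le> (lam - gamma / 2) * norm d"
  proof (cases "dz = 0")
    case True
    then show ?thesis using lam gamma by simp
  qed simp
  then have "norm dz \<le> (lam - gamma / 2) * norm d / lam" using lam_pos by (simp add: field_simps)
  also have "\<dots> = (1 - gamma / (2 * lam)) * norm d" using lam_pos by (simp add: field_simps)
  finally show ?thesis by (simp add: d_def dz_def)
qed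

subsection \<open>Averages of Hessians and the convergence theorem\<close>

lemma average_matrix_bound:
  fixes A B :: "nat \<Rightarrow> real^'p^'p"
  assumes "0 < m" and le: "\<And>j. j < m \<Longrightarrow> norm ((A j - B j) *v v) \<le> c"
  shows "norm (((1 / real m) *\<^sub>R (\<Sum>j<m. A j) - (1 / real m) *\<^sub>R (\<Sum>j<m. B j)) *v v) \<le> c"
proof -
  have "((1 / real m) *\<^sub>R (\<Sum>j<m. A j) - (1 / real m) *\<^sub>R (\<Sum>j<m. B j)) *v v
      = (1 / real m) *\<^sub>R (\<Sum>j<m. (A j - B j) *v v)"
    by (simp add: scaleR_diff_right[symmetric] sum_subtractf[symmetric]
        scaleR_matrix_vector_assoc[symmetric] matrix_vector_mult_sum_left)
  also have "norm \<dots> \<le> (1 / real m) * (\<Sum>j<m. c)"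
    unfolding norm_scaleR using le by (intro mult_mono sum_norm_le) auto
  also have "\<dots> = c" using assms(1) by simp
  finally show ?thesis .
qed

lemma norm_matrix_vector_le_spec_norm:
  fixes A :: "real^'p^'p"
  shows "norm (A *v v) \<le> spec_norm A * norm v"
  unfolding spec_norm_def by (rule onorm) (rule matrix_vector_mul_bounded_linear)

text \<open>Quantifying over \<open>x\<close> and \<open>lam\<close> inside the event lets
  thresholds depend on the draws in any way and covers every choice of minimizer in an
  update.\<close>

theorem theorem8:
  fixes f :: "nat \<Rightarrow> real^'p \<Rightarrow> real"
    and grad :: "nat \<Rightarrow> real^'p \<Rightarrow> real^'p"
    and hess :: "nat \<Rightarrow> real^'p \<Rightarrow> real^'p^'p"
    and n :: nat and D X :: "(real^'p) set" and xstar x0 :: "real^'p"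
    and L delta eps eps0 :: real
    and k0 :: nat and m0 m :: "nat \<Rightarrow> nat"
  defines "F \<equiv> \<lambda>x. (1 / real n) * (\<Sum>i<n. f i x)"
    and "gradF \<equiv> \<lambda>x. (1 / real n) *\<^sub>R (\<Sum>i<n. grad i x)"
    and "hessF \<equiv> \<lambda>x. (1 / real n) *\<^sub>R (\<Sum>i<n. hess i x)"
    and "Kstar \<equiv> Max ((\<lambda>i. spec_norm (hess i xstar)) ` {..<n})"
    and "gstar \<equiv> lambda_min ((1 / real n) *\<^sub>R (\<Sum>i<n. hess i xstar))"
    and "p \<equiv> real CARD('p)"
  assumes n_pos: "n \<ge> 1"
    and D_open: "open D" and D_convex: "convex D" and X_convex: "convex X"
    and f_diff: "\<And>i x. i < n \<Longrightarrow> x \<in> D \<Longrightarrow> (f i has_derivative (\<lambda>h. grad i x \<bullet> h)) (at x)"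
    and grad_diff: "\<And>i x. i < n \<Longrightarrow> x \<in> D \<Longrightarrow> (grad i has_derivative (\<lambda>h. hess i x *v h)) (at x)"
    and xstar_in: "xstar \<in> D \<inter> X"
    and xstar_locmin: "\<exists>e>0. \<forall>x\<in>D \<inter> X. dist x xstar < e \<longrightarrow> F xstar \<le> F x"
    and LipS: "L > 0" "\<And>i x. i < n \<Longrightarrow> x \<in> D \<inter> X \<Longrightarrow>
                  spec_norm (hess i x - hess i xstar) \<le> L * norm (x - xstar)"
    and SCS: "gstar > 0"
    and delta: "0 < delta" "delta < 1"
    and eps: "0 < eps" "eps < 1" "eps \<le> 1/6"
    and eps0: "0 < eps0" "eps0 < 1"
    and k0: "k0 \<ge> 1"
    and m0_size: "\<And>k. k < k0 \<Longrightarrow> real (m0 k) \<ge> 16 * Kstar^2 * ln (2 * p / delta) / (gstar^2 * eps0^2)"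
    and m_size: "\<And>k. k < k0 \<Longrightarrow> real (m k) \<ge> 16 * Kstar^2 * ln (2 * p / delta) / (gstar^2 * eps^2)"
    and x0_in: "x0 \<in> D \<inter> X"
    and x0_close: "norm (x0 - xstar) < gstar / (6 * (sqrt p + 1/2) * L)"
  shows "measure_pmf.prob (alg3_samples_pmf n k0 m0 m)
           {\<omega>. \<forall>(x :: nat \<Rightarrow> real^'p) (lam :: nat \<Rightarrow> real).
               (x 0 = x0 \<and>
                (\<forall>k<k0.
                   lam k > ((6 * sqrt p + 3) * (1 - eps)) / ((6 * sqrt p + 2) * (1 - eps0))
                           * lambda_min (subsampled_hess hess (fst (\<omega> k)) (m0 k) (x k)) \<and>
                   x (Suc k) \<in> D \<inter> X \<and>
                   (\<forall>y\<in>D \<inter> X.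
                      quad_model (F (x k)) (x k) (gradF (x k))
                        (spec_reg (lam k) (subsampled_hess hess (snd (\<omega> k)) (m k) (x k))) (x (Suc k))
                      \<le> quad_model (F (x k)) (x k) (gradF (x k))
                        (spec_reg (lam k) (subsampled_hess hess (snd (\<omega> k)) (m k) (x k))) y)))
               \<longrightarrow> (\<forall>k\<in>{1..k0}.
                      norm (x k - xstar) \<le> (1 - gstar / (2 * lam (k - 1))) * norm (x (k - 1) - xstar))}
         \<ge> (1 - delta) ^ (2 * k0)"
proof -
  define C where "C = D \<inter> X"
  have C: "convex C" "xstar \<in> C" "x0 \<in> C"
    using D_convex X_convex xstar_in x0_in by (auto simp: C_def intro: convex_Int)
  have hess_sym: "transpose (hess i x) = hess i x" if "i < n" "x \<in> C" for i x
    by (rule hessian_symmetric[OF D_open _ f_diff grad_diff]) (use that in \<open>auto simp: C_def\<close>)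
  have hessF_sym: "transpose (hessF x) = hessF x" if "x \<in> C" for x
    unfolding hessF_def using hess_sym that
    by (intro symmetric_matrix_scaleR symmetric_matrix_sum) auto
  have lip: "norm ((hess i x - hess i xstar) *v v) \<le> L * norm (x - xstar) * norm v"
    if "i < n" "x \<in> C" for i x v
    using order_trans[OF norm_matrix_vector_le_spec_norm mult_right_mono[OF LipS(2)]] that
    by (simp add: C_def)
  have Kb: "norm (hess i xstar *v v) \<le> Kstar * norm v" if "i < n" for i v
  proof -
    have "spec_norm (hess i xstar) \<le> Kstar" using that by (simp add: Kstar_def)
    then show ?thesis
      using norm_matrix_vector_le_spec_norm[of "hess i xstar" v] mult_right_mono[OF _ norm_ge_zero]
        order_trans by blast
  qed
  have gstar: "gstar = lambda_min (hessF xstar)" by (simp add: gstar_def hessF_def)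
  \<comment> \<open>\<open>gstar\<close> is at most the norm of the mean Hessian, which is at most
    \<open>Kstar\<close>; the Hoeffding bound divides by \<open>Kstar\<close>.\<close>
  have K_pos: "0 < Kstar"
  proof -
    obtain v :: "real^'p" where v: "norm v = 1" using vector_choose_size[of 1] by auto
    have "norm (hessF xstar *v v) \<le> Kstar"
      using average_matrix_bound[of n "\<lambda>i. hess i xstar" "\<lambda>_. 0" v Kstar] Kb[of _ v] v n_pos
      by (simp add: hessF_def)
    moreover have "gstar \<le> v \<bullet> (hessF xstar *v v)"
      using lambda_min_le_quadratic_form[OF hessF_sym[OF C(2)], of v] v by (simp add: gstar)
    moreover have "v \<bullet> (hessF xstar *v v) \<le> norm (hessF xstar *v v)"
      using norm_cauchy_schwarz[of v "hessF xstar *v v"] v by simp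
    ultimately show ?thesis using SCS by linarith
  qed
  have gradF_der: "(gradF has_derivative (\<lambda>h. hessF y *v h)) (at y)" if "y \<in> C" for y
  proof -
    have "(gradF has_derivative (\<lambda>h. (1 / real n) *\<^sub>R (\<Sum>i<n. hess i y *v h))) (at y)"
      unfolding gradF_def using that
      by (intro has_derivative_scaleR_right has_derivative_sum grad_diff) (auto simp: C_def)
    then show ?thesis
      by (simp add: hessF_def scaleR_matrix_vector_assoc[symmetric] matrix_vector_mult_sum_left)
  qed
  have F_der: "(F has_derivative (\<lambda>h. gradF xstar \<bullet> h)) (at xstar)"
  proof -
    have "(F has_derivative (\<lambda>h. (1 / real n) * (\<Sum>i<n. grad i xstar \<bullet> h))) (at xstar)"
      unfolding F_def using xstar_in
      by (intro has_derivative_mult_right has_derivative_sum f_diff) auto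
    then show ?thesis by (simp add: gradF_def inner_sum_left)
  qed
  have first_order: "0 \<le> gradF xstar \<bullet> (y - xstar)" if "y \<in> C" for y
    using xstar_locmin local_min_variational[OF C(1,2) that F_der] by (auto simp: C_def)
  have lipF: "norm ((hessF y - hessF xstar) *v v) \<le> L * norm (y - xstar) * norm v"
    if "y \<in> C" for y v
    unfolding hessF_def using n_pos lip that by (intro average_matrix_bound) auto
  \<comment> \<open>With accuracy \<open>e * gstar / 2\<close> the 4 of the Hoeffding bound becomes
    the 16 of the prescribed sample sizes.\<close>
  define good where "good e M = {S \<in> PiE_dflt {..<M} 0 (\<lambda>_. {..<n}). \<forall>v.
      norm (((1 / real M) *\<^sub>R (\<Sum>j<M. hess (S j) xstar) - (1 / real n) *\<^sub>R (\<Sum>i<n. hess i xstar)) *v v)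
      \<le> e * gstar / 2 * norm v}" for e :: real and M :: nat
  have fin: "finite (good e M)" for e M
    unfolding good_def by (intro finite_subset[OF Collect_restrict] finite_PiE_dflt) auto
  have prob_good: "1 - delta \<le> measure_pmf.prob (sample_pmf n M) (good e M)"
    if "0 < e" "16 * Kstar^2 * ln (2 * p / delta) / (gstar^2 * e^2) \<le> real M" for e M
    unfolding good_def
  proof (rule matrix_hoeffding[where K = Kstar])
    show "4 * Kstar\<^sup>2 * ln (2 * real CARD('p) / delta) / (e * gstar / 2)\<^sup>2 \<le> real M"
      using that by (simp add: p_def power_mult_distrib power_divide mult_ac)
  qed (use n_pos hess_sym C Kb K_pos SCS that delta in auto)
  have size_pos: "0 < M"
    if "0 < e" "16 * Kstar^2 * ln (2 * p / delta) / (gstar^2 * e^2) \<le> real M" for e :: real and M :: nat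
  proof -
    have "1 \<le> p" by (simp add: p_def)
    then have "delta < 2 * p" using delta by linarith
    then have "1 < 2 * p / delta" using delta by simp
    then have "0 < 16 * Kstar^2 * ln (2 * p / delta) / (gstar^2 * e^2)"
      using K_pos SCS that(1) by (intro divide_pos_pos mult_pos_pos ln_gt_zero) auto
    then show ?thesis using that(2) by linarith
  qed
  have sub_sym: "transpose (subsampled_hess hess S M x) = subsampled_hess hess S M x"
    if "S \<in> good e M" "x \<in> C" for S M x e
    unfolding subsampled_hess_def using that
    by (intro symmetric_matrix_scaleR symmetric_matrix_sum hess_sym) (auto simp: good_def PiE_dflt_def)
  have sub_lip: "norm ((subsampled_hess hess S M x - subsampled_hess hess S M xstar) *v v)
      \<le> L * norm (x - xstar) * norm v" if "S \<in> good e M" "x \<in> C" "0 < M" for S M x e v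
    unfolding subsampled_hess_def using that
    by (intro average_matrix_bound lip) (auto simp: good_def PiE_dflt_def)
  have sub_close: "norm ((subsampled_hess hess S M xstar - hessF xstar) *v v) \<le> e * gstar / 2 * norm v"
    if "S \<in> good e M" for S M e v
    using that by (simp add: good_def subsampled_hess_def hessF_def)
  \<comment> \<open>This is \<open>6 * (sqrt p + 1/2)\<close>, so the radius condition reads
    \<open>L * norm (x - xstar) < gstar / q\<close>, and \<open>q - 1\<close> is the other factor in
    the threshold rule.\<close>
  define q where "q = 6 * sqrt p + 3"
  have q: "3 < q" by (simp add: q_def p_def)
  have radius: "L * norm (x - xstar) < gstar / q"
    if "norm (x - xstar) \<le> norm (x0 - xstar)" for x
  proof -
    have "norm (x - xstar) < gstar / (q * L)"
      using that x0_close by (simp add: q_def algebra_simps)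
    then show ?thesis using q LipS(1) by (simp add: field_simps)
  qed
  have step: "norm (z - xstar) \<le> (1 - gstar / (2 * l)) * norm (x - xstar) \<and> 0 < l"
    if k: "k < k0" and x: "x \<in> C" and near: "norm (x - xstar) \<le> norm (x0 - xstar)" and z: "z \<in> C"
      and S0: "S0 \<in> good eps0 (m0 k)" and S: "S \<in> good eps (m k)"
      and l: "q * (1 - eps) / ((q - 1) * (1 - eps0)) * lambda_min (subsampled_hess hess S0 (m0 k) x) < l"
      and min: "\<And>y. y \<in> C \<Longrightarrow>
        quad_model (F x) x (gradF x) (spec_reg l (subsampled_hess hess S (m k) x)) z
        \<le> quad_model (F x) x (gradF x) (spec_reg l (subsampled_hess hess S (m k) x)) y"
    for k x z S0 S l
  proof -
    note r = radius[OF near]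
    have m0_pos: "0 < m0 k" using size_pos[OF eps0(1) m0_size[OF k]] .
    have m_pos: "0 < m k" using size_pos[OF eps(1) m_size[OF k]] .
    have "gstar - eps0 * gstar / 2 - L * norm (x - xstar) \<le> lambda_min (subsampled_hess hess S0 (m0 k) x)"
      using lambda_min_perturbation[OF sub_sym[OF S0 C(2)] hessF_sym[OF C(2)] sub_close[OF S0]]
        lambda_min_perturbation[OF sub_sym[OF S0 x] sub_sym[OF S0 C(2)] sub_lip[OF S0 x m0_pos]]
      by (simp add: gstar)
    \<comment> \<open>The sampling accuracy is \<open>eps0 / 2\<close> while the rule allows a loss
      of \<open>eps0\<close>; the spare half absorbs the cross term \<open>eps0 / q\<close>, since
      \<open>q > 3\<close>.\<close>
    moreover have "(q - 1) * (1 - eps0) / q * gstar \<le> gstar - eps0 * gstar / 2 - gstar / q"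
    proof -
      have "0 \<le> eps0 * gstar * (1 / 2 - 1 / q)"
        using eps0 SCS q by (intro mult_nonneg_nonneg) (auto simp: field_simps)
      moreover have "gstar - eps0 * gstar / 2 - gstar / q - (q - 1) * (1 - eps0) / q * gstar
          = eps0 * gstar * (1 / 2 - 1 / q)"
        using q by (simp add: field_simps)
      ultimately show ?thesis by linarith
    qed
    ultimately have low: "(q - 1) * (1 - eps0) / q * gstar \<le> lambda_min (subsampled_hess hess S0 (m0 k) x)"
      using r by linarith
    have "(1 - eps) * gstar = q * (1 - eps) / ((q - 1) * (1 - eps0)) * ((q - 1) * (1 - eps0) / q * gstar)"
      using q eps0 by simp
    also have "\<dots> \<le> q * (1 - eps) / ((q - 1) * (1 - eps0)) * lambda_min (subsampled_hess hess S0 (m0 k) x)"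
      using q eps eps0 by (intro mult_left_mono low) auto
    finally have "(1 - eps) * gstar < l" using l by linarith
    moreover have "5 / 6 * gstar \<le> (1 - eps) * gstar"
      using eps SCS by (intro mult_right_mono) auto
    ultimately have l56: "5 / 6 * gstar < l" by linarith
    have "norm (z - xstar) \<le> (1 - lambda_min (hessF xstar) / (2 * l)) * norm (x - xstar)"
    proof (rule regularized_newton_step[OF C(1) x C(2) z gradF_der lipF first_order[OF z]
          hessF_sym[OF C(2)] sub_sym[OF S x] sub_sym[OF S C(2)] sub_lip[OF S x m_pos]
          sub_close[OF S]])
      show "eps * gstar / 2 \<le> lambda_min (hessF xstar) / 12"
        using eps SCS mult_right_mono[OF eps(3), of gstar] by (simp add: gstar)
      show "(sqrt (real CARD('p)) + 1/2) * L * norm (x - xstar) \<le> lambda_min (hessF xstar) / 6"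
      proof -
        have "q * (L * norm (x - xstar)) \<le> gstar" using r q by (simp add: field_simps)
        then show ?thesis by (simp add: q_def p_def gstar algebra_simps)
      qed
      show "quad_model c x (gradF x) (spec_reg l (subsampled_hess hess S (m k) x)) z
          \<le> quad_model c x (gradF x) (spec_reg l (subsampled_hess hess S (m k) x)) y" if "y \<in> C" for y c
        using min[OF that] by (simp add: quad_model_def)
    qed (use SCS l56 gstar in auto)
    then show ?thesis using l56 SCS by (simp add: gstar)
  qed
  let ?G = "{\<omega>. \<forall>k<k0. fst (\<omega> k) \<in> good eps0 (m0 k) \<and> snd (\<omega> k) \<in> good eps (m k)}"
  have prob: "(1 - delta) ^ (2 * k0) \<le> measure_pmf.prob (alg3_samples_pmf n k0 m0 m) ?G"
    by (rule prob_independent_sample_pairs_ge)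
      (use delta prob_good m0_size m_size eps eps0 fin in auto)
  show ?thesis
  proof (rule order_trans[OF prob measure_pmf.finite_measure_mono];
      (intro subsetI CollectI allI impI)?, goal_cases)
    case (1 \<omega> x lam)
    note G = 1(1) and run = 1(2)
    have it: "norm (x (Suc k) - xstar) \<le> (1 - gstar / (2 * lam k)) * norm (x k - xstar) \<and> 0 < lam k"
      if k: "k < k0" and "x k \<in> C" "norm (x k - xstar) \<le> norm (x0 - xstar)" for k
    proof (rule step[OF k that(2,3), where ?S0.0 = "fst (\<omega> k)" and S = "snd (\<omega> k)"])
      show "q * (1 - eps) / ((q - 1) * (1 - eps0)) * lambda_min (subsampled_hess hess (fst (\<omega> k)) (m0 k) (x k)) < lam k"
        using run k by (auto simp: q_def add.commute[of 2])
    qed (use run G k in \<open>auto simp: C_def\<close>)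
    \<comment> \<open>A positive \<open>lam k\<close> puts the factor below 1, so the distance never
      exceeds its initial value and \<open>it\<close> applies again at the next iterate.\<close>
    have inv: "x k \<in> C \<and> norm (x k - xstar) \<le> norm (x0 - xstar)" if "k \<le> k0" for k
      using that
    proof (induction k)
      case 0
      then show ?case using run C by simp
    next
      case (Suc k)
      then have it': "norm (x (Suc k) - xstar) \<le> (1 - gstar / (2 * lam k)) * norm (x k - xstar)" "0 < lam k"
        using it[of k] by auto
      have "(1 - gstar / (2 * lam k)) * norm (x k - xstar) \<le> 1 * norm (x k - xstar)"
        using it'(2) SCS by (intro mult_right_mono) auto
      then show ?case using Suc it'(1) run by (auto simp: C_def)
    qed
    show "\<forall>k\<in>{1..k0}. norm (x k - xstar) \<le> (1 - gstar / (2 * lam (k - 1))) * norm (x (k - 1) - xstar)"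
    proof
      fix k assume k: "k \<in> {1..k0}"
      then obtain j where j: "k = Suc j" "j < k0" by (cases k) auto
      then show "norm (x k - xstar) \<le> (1 - gstar / (2 * lam (k - 1))) * norm (x (k - 1) - xstar)"
        using it[of j] inv[of j] by simp
    qed
  qed simp
qed

end
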